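(* Let $\mathcal{S}$ be a simplicial affine circle semigroup with $\mathcal{S}\neq\mathcal{C}$. Then $\mathcal{S}$ is Cohen-Macaulay if and only if $\mathrm{int}(\mathcal{S})=\mathrm{int}(\mathcal{C})$ and $\mathcal{S}\cap\tau_i=\langle n_i\rangle$ for $i=1,2$.
   Context: $\mathbb{N}$ denotes the nonnegative integers, $\mathbb{Q}_\ge$ and $\mathbb{R}_\ge$ the nonnegative rationals and reals. For nonempty $G\subset\mathbb{R}^2_\ge$, $L_{\mathbb{Q}_\ge}(G)=\{\sum_{i=1}^p q_if_i \mid p\in\mathbb{N},\ q_i\in\mathbb{Q}_\ge,\ f_i\in G\}$. Let $C$ be the circle (closed disc) with center $(a,b)$ and radius $r>0$, and for $i\in\mathbb{N}$ let $C_i$ be the circle (closed disc) with center $(ia,ib)$ and radius $ir$. The circle semigroup generated by $C$ is $\mathcal{S}=\bigcup_{i=0}^\infty C_i\cap\mathbb{N}^2$. It is affine if it is finitely generated. An affine semigroup in $\mathbb{N}^2$ of dimension $2$ is simplicial when it has two generators generating its rational cone $L_{\mathbb{Q}_\ge}(\cdot)$. Set $\mathcal{C}=L_{\mathbb{Q}_\ge}(C\cap\mathbb{R}^2_\ge)\cap\mathbb{N}^2$. Let $\tau_1,\tau_2$ be the two extremal rays (from the origin) of $\mathcal{C}$, $\tau_1$ being the one of greater slope, and let $n_i$ be the nonzero element of $\mathcal{S}\cap\tau_i$ of least Euclidean norm. $\mathrm{int}(\mathcal{S})=\mathcal{S}\setminus(\tau_1\cup\tau_2)$, $\mathrm{int}(\mathcal{C})=\mathcal{C}\setminus(\tau_1\cup\tau_2)$,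 and $\langle n_i\rangle=\{\lambda n_i\mid\lambda\in\mathbb{N}\}$. Fix a field $K$; a semigroup $S$ is called Cohen-Macaulay if the semigroup ring $K[S]$ is a Cohen-Macaulay ring. *)

theory Defs
  imports "HOL-Analysis.Analysis" "HOL-Library.Poly_Mapping" "HOL-Algebra.Ring_Divisibility"
begin

definition regular_sequence :: "('a, 'b) ring_scheme \<Rightarrow> 'a list \<Rightarrow> bool" where
  "regular_sequence R xs \<longleftrightarrow>
     set xs \<subseteq> carrier R \<and> genideal R (set xs) \<noteq> carrier R \<and>
     (\<forall>i<length xs. \<forall>y\<in>carrier R.
        xs ! i \<otimes>\<^bsub>R\<^esub> y \<in> genideal R (set (take i xs)) \<longrightarrow> y \<in> genideal R (set (take i xs)))"

definition ideal_depth :: "('a, 'b) ring_scheme \<Rightarrow> 'a set \<Rightarrow> enat" where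
  "ideal_depth R I = Sup {enat (length xs) |xs. regular_sequence R xs \<and> set xs \<subseteq> I}"

definition prime_height :: "('a, 'b) ring_scheme \<Rightarrow> 'a set \<Rightarrow> enat" where
  "prime_height R P =
     Sup {enat n |n. \<exists>Q :: nat \<Rightarrow> 'a set.
            (\<forall>i\<le>n. primeideal (Q i) R) \<and> (\<forall>i<n. Q i \<subset> Q (Suc i)) \<and> Q n = P}"

text \<open>This is the definition in Eisenbud, Commutative Algebra with a View Toward Algebraic
  Geometry, Section 18.2: a (commutative Noetherian) ring in which depth and codimension agree
  for every maximal ideal.\<close>

definition cohen_macaulay_ring :: "('a, 'b) ring_scheme \<Rightarrow> bool" where
  "cohen_macaulay_ring R \<longleftrightarrow>
     cring R \<and> noetherian_ring R \<and> (\<forall>P. maximalideal P R \<longrightarrow> ideal_depth R P = prime_height R P)"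

text \<open>Subsets of $\mathbb{N}^2$ are represented as subsets of the Euclidean plane
  \<^typ>\<open>real \<times> real\<close>, so no coercions of points are needed.\<close>

definition rational_cone :: "(real \<times> real) set \<Rightarrow> (real \<times> real) set" where
  "rational_cone G =
     {\<Sum>i<p. q i *\<^sub>R f i |(p::nat) (q :: nat \<Rightarrow> real) f. \<forall>i<p. q i \<in> \<rat> \<and> 0 \<le> q i \<and> f i \<in> G}"

definition generated_semigroup :: "(real \<times> real) set \<Rightarrow> (real \<times> real) set" where
  "generated_semigroup G =
     {\<Sum>i<p. real (k i) *\<^sub>R f i |(p::nat) (k :: nat \<Rightarrow> nat) f. \<forall>i<p. f i \<in> G}"

definition affine_semigroup :: "(real \<times> real) set \<Rightarrow> bool" where
  "affine_semigroup S \<longleftrightarrow> S \<subseteq> \<nat> \<times> \<nat> \<and> (\<exists>A. finite A \<and> S = generated_semigroup A)"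

text \<open>The dimension of an affine semigroup is the rank of the group it generates, that is, the
  dimension of its real span.\<close>

definition simplicial_affine_semigroup :: "(real \<times> real) set \<Rightarrow> bool" where
  "simplicial_affine_semigroup S \<longleftrightarrow>
     affine_semigroup S \<and> dim S = 2 \<and>
     (\<exists>A. finite A \<and> S = generated_semigroup A \<and>
        (\<exists>u\<in>A. \<exists>v\<in>A. rational_cone {u, v} = rational_cone S))"

definition semigroup_ring :: "(real \<times> real) set \<Rightarrow> ((real \<times> real) \<Rightarrow>\<^sub>0 'k::field) ring" where
  "semigroup_ring S =
     \<lparr>carrier = {p. Poly_Mapping.keys p \<subseteq> S}, mult = (*), one = 1, zero = 0, add = (+)\<rparr>"

definition cohen_macaulay_semigroup :: "'k::field itself \<Rightarrow> (real \<times> real) set \<Rightarrow> bool" where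
  "cohen_macaulay_semigroup K S \<longleftrightarrow>
     cohen_macaulay_ring (semigroup_ring S :: ((real \<times> real) \<Rightarrow>\<^sub>0 'k) ring)"

definition circle_semigroup :: "real \<times> real \<Rightarrow> real \<Rightarrow> (real \<times> real) set" where
  "circle_semigroup c r = (\<Union>i::nat. cball (real i *\<^sub>R c) (real i * r)) \<inter> (\<nat> \<times> \<nat>)"

definition circle_cone :: "real \<times> real \<Rightarrow> real \<Rightarrow> (real \<times> real) set" where
  "circle_cone c r = rational_cone (cball c r \<inter> ({0..} \<times> {0..})) \<inter> (\<nat> \<times> \<nat>)"

definition extremal_ray :: "(real \<times> real) set \<Rightarrow> (real \<times> real) set \<Rightarrow> bool" where
  "extremal_ray T \<tau> \<longleftrightarrow>
     (\<exists>d. d \<noteq> 0 \<and> \<tau> = {t *\<^sub>R d |t. 0 \<le> t}) \<and> \<tau> face_of (convex_cone hull T)"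

text \<open>Comparison of slopes $y/x > y'/x'$ of rays in the closed first quadrant, multiplied out so
  that the vertical ray (slope $\infty$) is covered.\<close>

definition steeper :: "(real \<times> real) set \<Rightarrow> (real \<times> real) set \<Rightarrow> bool" where
  "steeper \<tau> \<tau>' \<longleftrightarrow>
     (\<forall>(x, y)\<in>\<tau> - {0}. \<forall>(x', y')\<in>\<tau>' - {0}. y * x' > y' * x)"

definition least_on_ray :: "(real \<times> real) set \<Rightarrow> (real \<times> real) set \<Rightarrow> real \<times> real \<Rightarrow> bool" where
  "least_on_ray S \<tau> n \<longleftrightarrow> is_arg_min norm (\<lambda>v. v \<in> S \<inter> \<tau> \<and> v \<noteq> 0) n"

end

theory Submission
  imports Defs
begin

text \<open>
  Write \<open>K[S]\<close> for the semigroup ring and \<open>x^z\<close> for the monomial with exponent \<open>z\<close>. Call \<open>S\<close>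
  \<^emph>\<open>saturated\<close> if \<open>z + n\<^sub>1 \<in> S\<close> and \<open>z + n\<^sub>2 \<in> S\<close> imply \<open>z \<in> S\<close>, for every point \<open>z\<close> of the
  plane. Both sides of the theorem are equivalent to saturation; the first equivalence is algebra,
  the second one is about discs and lattice points.

  \<^bold>\<open>Cohen-Macaulay implies saturated\<close> (\<open>cohen_macaulay_imp_saturated\<close>). The maximal ideal spanned by
  the monomials with nonzero exponent lies at the end of a chain of three primes, one for each of the
  faces \<open>S\<close>, \<open>S \<inter> \<tau>\<^sub>1\<close> and \<open>{0}\<close>, so its height is at least 2 and it contains a regular sequence
  \<open>f, g\<close>. For such a pair, an element \<open>m\<close> of the group ring with \<open>f m\<close> and \<open>g m\<close> in \<open>K[S]\<close> lies in
  \<open>K[S]\<close> itself. All but finitely many elements of \<open>S\<close> lie in \<open>(n\<^sub>1 + S) \<union> (n\<^sub>2 + S)\<close>, hence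
  \<open>f^i g^j x^z\<close> is in \<open>K[S]\<close> once \<open>i + j\<close> is large, and one can descend to \<open>i = j = 0\<close>.

  \<^bold>\<open>Saturated implies Cohen-Macaulay\<close> (\<open>saturated_imp_cohen_macaulay\<close>). Depth never exceeds height
  (\<open>ideal_depth_le_prime_height\<close>), so it suffices to find regular sequences as long as chains of
  primes. Counting monomials shows that any three elements of \<open>K[S]\<close> are algebraically dependent over
  \<open>K\<close>. Reading off the lowest coefficient of such a relation along a chain of primes gives two things:
  chains have length at most 2, and a prime of height 2 contains nonzero polynomials \<open>p\<close> in
  \<open>x^n\<^sub>1\<close> and \<open>q\<close> in \<open>x^n\<^sub>2\<close>. If \<open>S\<close> is saturated then \<open>p, q\<close> is a regular sequence
  (\<open>saturated_imp_regular\<close>): the possible remainders of division by \<open>p\<close> are spanned by a set of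
  monomials that multiplication by \<open>x^n\<^sub>2\<close> preserves. That \<open>K[S]\<close> is Noetherian follows from
  Dickson's lemma by comparing leading terms.

  \<^bold>\<open>Saturated means: full interior and cyclic rays\<close>. A point of \<open>C\<close> off the ray of \<open>n \<in> S\<close> enters \<open>S\<close>
  after adding a large multiple of \<open>n\<close> (\<open>translate_cone_point_into_semigroup\<close>), because the discs of
  radius \<open>N r\<close> around \<open>N c\<close> grow over every such point in the direction of \<open>n\<close>. Applied to \<open>n\<^sub>1\<close>
  and \<open>n\<^sub>2\<close> this puts the whole interior of \<open>C\<close> into a saturated \<open>S\<close>. On an extremal ray there are two
  cases: if the ray is tangent to the disc, then \<open>S\<close> meets it in lattice multiples of the point of
  tangency, and otherwise the same growth argument applies on the ray itself; in both cases the
  fractional part of an element modulo \<open>n\<^sub>i\<close> stays in \<open>S\<close> and must vanish. The converse is a short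
  computation with the coordinates of \<open>z\<close> in the basis \<open>n\<^sub>1, n\<^sub>2\<close>.
\<close>

section \<open>Depth and height in commutative rings\<close>

text \<open>
  Krull's theorem: an ideal that is maximal among those that contain \<open>I\<close> and miss the multiplicative
  set \<open>M\<close> is prime. If it contained \<open>a b\<close> but neither factor, then adjoining \<open>a\<close> and adjoining \<open>b\<close>
  would each give an element of \<open>M\<close>, and the product of these two would lie in the ideal.
\<close>

lemma (in cring) ex_primeideal_avoiding:
  assumes I: "ideal I R" and M: "M \<subseteq> carrier R" "\<one> \<in> M"
    and mult: "\<And>a b. a \<in> M \<Longrightarrow> b \<in> M \<Longrightarrow> a \<otimes> b \<in> M" and disj: "I \<inter> M = {}"
  shows "\<exists>Q. primeideal Q R \<and> I \<subseteq> Q \<and> Q \<inter> M = {}"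
proof -
  define A where "A = {J. ideal J R \<and> I \<subseteq> J \<and> J \<inter> M = {}}"
  have "\<exists>Q\<in>A. \<forall>X\<in>A. Q \<subseteq> X \<longrightarrow> X = Q"
  proof (rule subset_Zorn)
    fix C assume C: "subset.chain A C"
    show "\<exists>U\<in>A. \<forall>X\<in>C. X \<subseteq> U"
    proof (cases "C = {}")
      case True
      have "I \<in> A" using I disj by (simp add: A_def)
      then show ?thesis using True by blast
    next
      case False
      have "subset.chain {J. ideal J R} C"
        using C unfolding pred_on.chain_def A_def by blast
      then have "ideal (\<Union>C) R" using chain_Union_is_ideal[of C] False by simp
      moreover have "I \<subseteq> \<Union>C" "\<Union>C \<inter> M = {}"
        using C False unfolding pred_on.chain_def A_def by blast+
      ultimately have "\<Union>C \<in> A" by (simp add: A_def)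
      then show ?thesis by blast
    qed
  qed
  then obtain Q where QA: "Q \<in> A" and maxA: "\<And>X. X \<in> A \<Longrightarrow> Q \<subseteq> X \<Longrightarrow> X = Q"
    by blast
  have Q: "ideal Q R" "I \<subseteq> Q" "Q \<inter> M = {}" using QA by (auto simp: A_def)
  have max: "X = Q" if "ideal X R" "X \<inter> M = {}" "Q \<subseteq> X" for X
    using maxA[of X] that Q(2) by (auto simp: A_def)
  interpret Q: ideal Q R by fact
  have meets: "\<exists>q\<in>Q. \<exists>x\<in>carrier R. q \<oplus> x \<otimes> a \<in> M" if a: "a \<in> carrier R" "a \<notin> Q" for a
  proof -
    let ?J = "set_add R Q (PIdl a)"
    have J: "ideal ?J R" using add_ideals[OF Q(1) cgenideal_ideal[OF a(1)]] .
    have el: "q \<oplus> x \<otimes> a \<in> ?J" if "q \<in> Q" "x \<in> carrier R" for q x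
      using that unfolding set_add_def' cgenideal_def by blast
    have "Q \<subseteq> ?J"
    proof
      fix q assume q: "q \<in> Q"
      then show "q \<in> ?J" using el[OF q zero_closed] a(1) Q.Icarr[OF q] by simp
    qed
    moreover have "a \<in> ?J" using el[OF Q.zero_closed one_closed] a(1) by simp
    ultimately have "?J \<inter> M \<noteq> {}" using max[OF J] a(2) by blast
    then show ?thesis unfolding set_add_def' cgenideal_def by blast
  qed
  have "primeideal Q R"
  proof (rule primeidealI[OF Q(1) is_cring])
    show "carrier R \<noteq> Q" using Q(3) M by blast
    fix a b assume ab: "a \<in> carrier R" "b \<in> carrier R" "a \<otimes> b \<in> Q"
    show "a \<in> Q \<or> b \<in> Q"
    proof (rule ccontr)
      assume "\<not> (a \<in> Q \<or> b \<in> Q)"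
      then obtain q x q' x' where qx: "q \<in> Q" "x \<in> carrier R" "q \<oplus> x \<otimes> a \<in> M"
        "q' \<in> Q" "x' \<in> carrier R" "q' \<oplus> x' \<otimes> b \<in> M"
        using meets ab by meson
      note c = Q.Icarr[OF qx(1)] Q.Icarr[OF qx(4)] qx(2,5) ab(1,2)
      have "(q \<oplus> x \<otimes> a) \<otimes> (q' \<oplus> x' \<otimes> b)
          = q \<otimes> (q' \<oplus> x' \<otimes> b) \<oplus> ((x \<otimes> a) \<otimes> q' \<oplus> (x \<otimes> x') \<otimes> (a \<otimes> b))"
        using c by algebra
      also have "\<dots> \<in> Q"
        using c qx(1,4) ab(3) Q.I_l_closed Q.I_r_closed by (intro Q.a_closed) auto
      finally show False using mult[OF qx(3,6)] Q(3) by blast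
    qed
  qed
  then show ?thesis using Q by blast
qed

text \<open>
  A last element \<open>y\<close> of the sequence can be dropped at the price of a smaller prime. As \<open>y\<close> is
  regular modulo the ideal \<open>I\<close> of the other elements, no product \<open>s y^n\<close> with \<open>s \<notin> P\<close> lies in \<open>I\<close>;
  a prime \<open>Q \<supseteq> I\<close> that avoids all these products lies in \<open>P\<close> and does not contain \<open>y\<close>.
\<close>

lemma (in cring) regular_sequence_prime_chain:
  assumes "regular_sequence R xs" "set xs \<subseteq> P" "primeideal P R"
  shows "\<exists>Q. (\<forall>i\<le>length xs. primeideal (Q i) R) \<and> (\<forall>i<length xs. Q i \<subset> Q (Suc i))
           \<and> Q (length xs) = P"
  using assms
proof (induction xs arbitrary: P rule: rev_induct)
  case Nil
  then show ?case by (intro exI[of _ "\<lambda>_. P"]) auto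
next
  case (snoc y xs)
  interpret P: primeideal P R by fact
  let ?I = "Idl (set xs)"
  have xs: "set xs \<subseteq> carrier R" and y: "y \<in> carrier R" "y \<in> P" "set xs \<subseteq> P"
    using snoc.prems by (auto simp: regular_sequence_def)
  have I: "ideal ?I R" using genideal_ideal[OF xs] .
  interpret I: ideal ?I R by fact
  have IP: "?I \<subseteq> P" using genideal_minimal[OF P.is_ideal] y(3) by blast
  have regular_y: "z \<in> ?I" if "z \<in> carrier R" "y \<otimes> z \<in> ?I" for z
  proof -
    have "(xs @ [y]) ! length xs \<otimes> z \<in> genideal R (set (take (length xs) (xs @ [y])))"
      using that by simp
    then have "z \<in> genideal R (set (take (length xs) (xs @ [y])))"
      using snoc.prems(1) that(1) unfolding regular_sequence_def by (metis length_append_singleton lessI)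
    then show ?thesis by simp
  qed
  \<comment> \<open>Taking \<open>n = 0\<close> makes a prime that avoids \<open>M\<close> lie in \<open>P\<close>; taking \<open>s = 1\<close> keeps \<open>y\<close> out of it.\<close>
  define M where "M = {s \<otimes> y [^] n |s (n::nat). s \<in> carrier R \<and> s \<notin> P}"
  have el: "s \<otimes> y [^] n \<in> M" if "s \<in> carrier R" "s \<notin> P" for s and n :: nat
    using that by (auto simp: M_def)
  have one: "\<one> \<notin> P" using P.I_notcarr P.one_imp_carrier by blast
  have "\<exists>Q. primeideal Q R \<and> ?I \<subseteq> Q \<and> Q \<inter> M = {}"
  proof (rule ex_primeideal_avoiding[OF I])
    show "M \<subseteq> carrier R" using y by (auto simp: M_def)
    show "\<one> \<in> M" using el[OF one_closed one, of 0] by simp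
    show "a \<otimes> b \<in> M" if ab: "a \<in> M" "b \<in> M" for a b
    proof -
      obtain s n t m where st: "a = s \<otimes> y [^] (n::nat)" "s \<in> carrier R" "s \<notin> P"
        "b = t \<otimes> y [^] (m::nat)" "t \<in> carrier R" "t \<notin> P" using ab by (auto simp: M_def)
      have "a \<otimes> b = (s \<otimes> t) \<otimes> (y [^] n \<otimes> y [^] m)" using st y
        by (simp add: m_ac)
      also have "\<dots> = (s \<otimes> t) \<otimes> y [^] (n + m)" using y by (simp add: nat_pow_mult)
      finally show ?thesis using el[of "s \<otimes> t" "n + m"] st P.I_prime[of s t] by auto
    qed
    have "s \<in> P" if "s \<in> carrier R" "s \<otimes> y [^] (n::nat) \<in> ?I" for s n
      using that(2)
    proof (induction n)
      case 0
      then show ?case using that(1) IP by auto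
    next
      case (Suc n)
      have "y \<otimes> (s \<otimes> y [^] n) = s \<otimes> y [^] Suc n" using that(1) y by (simp add: m_ac)
      then show ?case using regular_y[of "s \<otimes> y [^] n"] Suc that(1) y by simp
    qed
    then show "?I \<inter> M = {}" by (auto simp: M_def)
  qed
  then obtain Q where Q: "primeideal Q R" "?I \<subseteq> Q" "Q \<inter> M = {}" by blast
  interpret Q: primeideal Q R by fact
  have QP: "Q \<subseteq> P"
  proof
    fix s assume "s \<in> Q"
    then show "s \<in> P" using el[of s 0] Q(3) Q.Icarr by fastforce
  qed
  have "y \<notin> Q" using el[OF one_closed one, of 1] Q(3) y by auto
  then have sub: "Q \<subset> P" using QP y by blast
  have "regular_sequence R xs"
  proof -
    have "?I \<noteq> carrier R" using IP P.I_notcarr P.a_subset by blast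
    moreover have "take i (xs @ [y]) = take i xs" "(xs @ [y]) ! i = xs ! i" if "i < length xs" for i
      using that by (auto simp: nth_append)
    ultimately show ?thesis using snoc.prems(1) xs unfolding regular_sequence_def
      by (metis (no_types, lifting) length_append_singleton less_SucI)
  qed
  moreover have "set xs \<subseteq> Q" using genideal_self[OF xs] Q(2) by blast
  ultimately obtain F where F: "\<forall>i\<le>length xs. primeideal (F i) R"
    "\<forall>i<length xs. F i \<subset> F (Suc i)" "F (length xs) = Q"
    using snoc.IH Q(1) by blast
  let ?F = "\<lambda>i. if i \<le> length xs then F i else P"
  show ?case
  proof (intro exI[of _ ?F] conjI allI impI)
    fix i assume "i < length (xs @ [y])"
    then consider "i < length xs" | "i = length xs" by fastforce
    then show "?F i \<subset> ?F (Suc i)" using F sub by cases auto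
  next
    fix i show "primeideal (?F i) R" using F(1) snoc.prems(3) by simp
  qed simp
qed

lemma (in cring) ideal_depth_le_prime_height:
  assumes "primeideal P R"
  shows "ideal_depth R P \<le> prime_height R P"
  unfolding ideal_depth_def
proof (rule Sup_least)
  fix n assume "n \<in> {enat (length xs) |xs. regular_sequence R xs \<and> set xs \<subseteq> P}"
  then obtain xs where "n = enat (length xs)" "regular_sequence R xs" "set xs \<subseteq> P" by blast
  then show "n \<le> prime_height R P"
    using regular_sequence_prime_chain[OF _ _ assms, of xs] unfolding prime_height_def
    by (intro Sup_upper) blast
qed

section \<open>Products in the group ring of the plane\<close>

text \<open>
  Subtraction of exponents turns the convolution into a single sum over the exponents of \<open>f\<close>.
\<close>

lemma lookup_times:
  fixes f g :: "'a::ab_group_add \<Rightarrow>\<^sub>0 'k::semiring_0"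
  shows "Poly_Mapping.lookup (f * g) k
    = (\<Sum>a\<in>Poly_Mapping.keys f. Poly_Mapping.lookup f a * Poly_Mapping.lookup g (k - a))"
proof -
  have "(\<Sum>q. Poly_Mapping.lookup g q when k = l + q) = Poly_Mapping.lookup g (k - l)" for l
  proof -
    have "(\<lambda>q. Poly_Mapping.lookup g q when k = l + q)
        = (\<lambda>q. Poly_Mapping.lookup g q when k - l = q)"
      by (intro ext when_cong) (auto simp: algebra_simps)
    then show ?thesis by (simp only: Sum_any_when_equal')
  qed
  then have "Poly_Mapping.lookup (f * g) k
      = (\<Sum>l. Poly_Mapping.lookup f l * Poly_Mapping.lookup g (k - l))"
    by (simp add: lookup_mult)
  also have "\<dots> = (\<Sum>a\<in>Poly_Mapping.keys f. Poly_Mapping.lookup f a * Poly_Mapping.lookup g (k - a))"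
    by (rule Sum_any.expand_superset) (auto simp: in_keys_iff)
  finally show ?thesis .
qed

text \<open>
  There is no cancellation at an exponent that is a sum of exponents of \<open>f\<close> and \<open>g\<close> in one way only.
\<close>

lemma lookup_times_unique:
  fixes f g :: "'a::ab_group_add \<Rightarrow>\<^sub>0 'k::semiring_0"
  assumes "\<And>a b. a \<in> Poly_Mapping.keys f \<Longrightarrow> b \<in> Poly_Mapping.keys g \<Longrightarrow> a + b = \<alpha> + \<beta> \<Longrightarrow> a = \<alpha>"
  shows "Poly_Mapping.lookup (f * g) (\<alpha> + \<beta>) = Poly_Mapping.lookup f \<alpha> * Poly_Mapping.lookup g \<beta>"
proof -
  let ?t = "\<lambda>a. Poly_Mapping.lookup f a * Poly_Mapping.lookup g (\<alpha> + \<beta> - a)"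
  have "?t a = 0" if "a \<noteq> \<alpha>" for a
    using assms[of a "\<alpha> + \<beta> - a"] that by (fastforce simp: in_keys_iff)
  then have "sum ?t (Poly_Mapping.keys f) = (\<Sum>a\<in>Poly_Mapping.keys f. if a = \<alpha> then ?t \<alpha> else 0)"
    by (intro sum.cong) auto
  also have "\<dots> = ?t \<alpha>" by (auto simp: in_keys_iff)
  finally show ?thesis by (simp add: lookup_times)
qed

lemma lookup_single_times:
  fixes f :: "'a::ab_group_add \<Rightarrow>\<^sub>0 'k::semiring_0"
  shows "Poly_Mapping.lookup (Poly_Mapping.single a c * f) k = c * Poly_Mapping.lookup f (k - a)"
  by (cases "c = 0") (simp_all add: lookup_times)

lemma sum_monomials:
  "(\<Sum>a\<in>Poly_Mapping.keys f. Poly_Mapping.single a (Poly_Mapping.lookup f a)) = f"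
  by (rule poly_mapping_eqI)
    (auto simp: lookup_sum lookup_single when_def in_keys_iff)

lemma keys_sum_subset:
  assumes "\<And>i. i \<in> I \<Longrightarrow> Poly_Mapping.keys (F i) \<subseteq> T"
  shows "Poly_Mapping.keys (sum F I) \<subseteq> T"
  using assms
proof (induction I rule: infinite_finite_induct)
  case (insert i I)
  then show ?case using keys_add[of "F i" "sum F I"] by fastforce
qed auto

text \<open>
  A total order that is compatible with addition, so that leading exponents add up in products. On
  lattice points of the quadrant it is also well-founded.
\<close>

definition lex_less :: "real \<times> real \<Rightarrow> real \<times> real \<Rightarrow> bool" where
  "lex_less p q \<longleftrightarrow> fst p < fst q \<or> fst p = fst q \<and> snd p < snd q"

lemma ex_lex_greatest:
  assumes "finite A" "A \<noteq> {}"
  shows "\<exists>m\<in>A. \<forall>a\<in>A. a \<noteq> m \<longrightarrow> lex_less a m"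
  using assms
proof (induction A rule: finite_ne_induct)
  case (insert x A)
  then obtain m where m: "m \<in> A" "\<And>a. a \<in> A \<Longrightarrow> a \<noteq> m \<Longrightarrow> lex_less a m" by blast
  have "x \<noteq> m" using insert m by blast
  then have "lex_less x m \<or> lex_less m x" by (auto simp: lex_less_def prod_eq_iff)
  then show ?case
  proof
    assume "lex_less x m"
    then show ?thesis using m by blast
  next
    assume *: "lex_less m x"
    then have "lex_less a x" if "a \<in> A" for a
      using m(2)[OF that] by (cases "a = m") (auto simp: lex_less_def)
    then show ?thesis by blast
  qed
qed auto

lemma lex_greatest_unique_sum:
  assumes "a \<noteq> \<alpha> \<Longrightarrow> lex_less a \<alpha>" "b \<noteq> \<beta> \<Longrightarrow> lex_less b \<beta>" "a + b = \<alpha> + \<beta>"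
  shows "a = \<alpha>"
  using assms unfolding lex_less_def prod_eq_iff fst_add snd_add by argo

text \<open>
  The product of the leading terms of two nonzero elements survives.
\<close>

lemma plane_times_eq_0_iff:
  fixes f g :: "(real \<times> real) \<Rightarrow>\<^sub>0 'k::idom"
  shows "f * g = 0 \<longleftrightarrow> f = 0 \<or> g = 0"
proof (rule iffI, rule ccontr)
  assume fg: "f * g = 0" and "\<not> (f = 0 \<or> g = 0)"
  then have ne: "Poly_Mapping.keys f \<noteq> {}" "Poly_Mapping.keys g \<noteq> {}"
    by (auto simp: poly_mapping_eq_iff fun_eq_iff in_keys_iff)
  obtain \<alpha> where \<alpha>: "\<alpha> \<in> Poly_Mapping.keys f"
    "\<And>a. a \<in> Poly_Mapping.keys f \<Longrightarrow> a \<noteq> \<alpha> \<Longrightarrow> lex_less a \<alpha>"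
    using ex_lex_greatest[OF finite_keys ne(1)] by blast
  obtain \<beta> where \<beta>: "\<beta> \<in> Poly_Mapping.keys g"
    "\<And>a. a \<in> Poly_Mapping.keys g \<Longrightarrow> a \<noteq> \<beta> \<Longrightarrow> lex_less a \<beta>"
    using ex_lex_greatest[OF finite_keys ne(2)] by blast
  have "Poly_Mapping.lookup (f * g) (\<alpha> + \<beta>) = Poly_Mapping.lookup f \<alpha> * Poly_Mapping.lookup g \<beta>"
    by (rule lookup_times_unique) (rule lex_greatest_unique_sum, use \<alpha> \<beta> in auto)
  then show False using fg \<alpha>(1) \<beta>(1) by (simp add: in_keys_iff)
qed auto

lemma plane_times_cancel:
  fixes f g h :: "(real \<times> real) \<Rightarrow>\<^sub>0 'k::idom"
  assumes "f * g = f * h" "f \<noteq> 0"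
  shows "g = h"
proof -
  have "f * (g - h) = 0" using assms(1) by (simp add: algebra_simps)
  then show ?thesis using assms(2) plane_times_eq_0_iff[of f "g - h"] by auto
qed

section \<open>The semigroup ring of a submonoid of the lattice quadrant\<close>

locale plane_monoid =
  fixes S :: "(real \<times> real) set"
  assumes nat: "S \<subseteq> \<nat> \<times> \<nat>" and zero_in: "0 \<in> S"
    and add_in: "x \<in> S \<Longrightarrow> y \<in> S \<Longrightarrow> x + y \<in> S"
begin

text \<open>
  Stated for all elements of the group ring of the plane: the proofs also multiply by monomials whose
  exponents are outside \<open>S\<close> and cancel in the larger ring.
\<close>

definition supported :: "((real \<times> real) \<Rightarrow>\<^sub>0 'k::field) \<Rightarrow> bool" where
  "supported f \<longleftrightarrow> Poly_Mapping.keys f \<subseteq> S"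

lemma semigroup_ring_simps [simp]:
  "(f \<in> carrier (semigroup_ring S)) = supported f"
  "mult (semigroup_ring S) = (*)" "one (semigroup_ring S) = 1"
  "zero (semigroup_ring S) = 0" "add (semigroup_ring S) = (+)"
  by (auto simp: semigroup_ring_def supported_def)

lemma supported_0 [simp]: "supported 0" and supported_1 [simp]: "supported 1"
  using zero_in by (auto simp: supported_def)

lemma supported_add: "supported f \<Longrightarrow> supported g \<Longrightarrow> supported (f + g)"
  using keys_add[of f g] by (auto simp: supported_def)

lemma supported_times: "supported f \<Longrightarrow> supported g \<Longrightarrow> supported (f * g)"
  using keys_mult[of f g] add_in by (fastforce simp: supported_def)

lemma supported_single: "a \<in> S \<Longrightarrow> supported (Poly_Mapping.single a c)"
  by (auto simp: supported_def)

lemma supported_const [simp]: "supported (Poly_Mapping.single 0 c)"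
  using zero_in by (rule supported_single)

lemma supported_uminus:
  fixes f :: "(real \<times> real) \<Rightarrow>\<^sub>0 'k::field" shows "supported f \<Longrightarrow> supported (- f)"
  by (auto simp: supported_def in_keys_iff)

lemma supported_diff:
  fixes f :: "(real \<times> real) \<Rightarrow>\<^sub>0 'k::field"
  shows "supported f \<Longrightarrow> supported g \<Longrightarrow> supported (f - g)"
  using supported_add[of f "- g"] by (simp add: supported_uminus)

lemma supported_sum: "(\<And>i. i \<in> I \<Longrightarrow> supported (F i)) \<Longrightarrow> supported (sum F I)"
  using keys_sum_subset[of I F S] by (auto simp: supported_def)

lemma supported_power: "supported f \<Longrightarrow> supported (f ^ n)"
  by (induction n) (simp_all add: supported_times)

lemmas supported_intros = supported_add supported_times supported_single supported_uminus
  supported_diff supported_sum supported_power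

sublocale R: cring "semigroup_ring S :: ((real \<times> real) \<Rightarrow>\<^sub>0 'k::field) ring"
proof (rule cringI)
  let ?R = "semigroup_ring S :: ((real \<times> real) \<Rightarrow>\<^sub>0 'k) ring"
  show "abelian_group ?R"
  proof (rule abelian_groupI)
    fix x assume "x \<in> carrier ?R"
    then show "\<exists>y\<in>carrier ?R. y \<oplus>\<^bsub>?R\<^esub> x = \<zero>\<^bsub>?R\<^esub>"
      by (intro bexI[of _ "- x"]) (auto intro: supported_intros)
  qed (auto simp: add_ac intro: supported_intros)
  show "Group.comm_monoid ?R"
    by (rule comm_monoidI) (auto simp: mult_ac intro: supported_intros)
qed (auto simp: algebra_simps)

text \<open>
  Additive inverses need no condition of their own: they are multiples by the constant \<open>-1\<close>.
\<close>

lemma ideal_iff: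
  fixes I :: "((real \<times> real) \<Rightarrow>\<^sub>0 'k::field) set"
  shows "ideal I (semigroup_ring S) \<longleftrightarrow> (\<forall>f\<in>I. supported f) \<and> 0 \<in> I \<and>
    (\<forall>f\<in>I. \<forall>g\<in>I. f + g \<in> I) \<and> (\<forall>f\<in>I. \<forall>h. supported h \<longrightarrow> h * f \<in> I)" (is "?L \<longleftrightarrow> ?R")
proof
  assume ?L
  then interpret I: ideal I "semigroup_ring S" .
  show ?R using I.Icarr I.zero_closed I.a_closed I.I_l_closed by simp
next
  assume R: ?R
  show ?L
  proof (rule idealI)
    show "Ring.ring (semigroup_ring S :: ((real \<times> real) \<Rightarrow>\<^sub>0 'k) ring)" by (rule R.ring_axioms)
    show "subgroup I (add_monoid (semigroup_ring S))"
    proof (rule R.add.subgroupI)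
      fix a assume a: "a \<in> I"
      have sa: "supported a" using R a by blast
      have "\<ominus>\<^bsub>semigroup_ring S\<^esub> a = - a"
        by (rule R.minus_equality) (use sa supported_uminus in auto)
      moreover have "(- 1) * a \<in> I" using R a by (meson supported_1 supported_uminus)
      ultimately show "\<ominus>\<^bsub>semigroup_ring S\<^esub> a \<in> I" by simp
    qed (use R in auto)
  next
    fix a x :: "(real \<times> real) \<Rightarrow>\<^sub>0 'k"
    assume "a \<in> I" "x \<in> carrier (semigroup_ring S)"
    then show "a \<otimes>\<^bsub>semigroup_ring S\<^esub> x \<in> I" using R by (simp add: mult.commute)
  qed (use R in auto)
qed

lemma idealD:
  fixes I :: "((real \<times> real) \<Rightarrow>\<^sub>0 'k::field) set"
  assumes "ideal I (semigroup_ring S)"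
  shows "f \<in> I \<Longrightarrow> supported f" "0 \<in> I" "f \<in> I \<Longrightarrow> g \<in> I \<Longrightarrow> f + g \<in> I"
    "f \<in> I \<Longrightarrow> supported h \<Longrightarrow> h * f \<in> I" "f \<in> I \<Longrightarrow> supported h \<Longrightarrow> f * h \<in> I"
    "f \<in> I \<Longrightarrow> g \<in> I \<Longrightarrow> f - g \<in> I"
proof -
  note I = assms[unfolded ideal_iff]
  show "f \<in> I \<Longrightarrow> supported f" "0 \<in> I" "f \<in> I \<Longrightarrow> g \<in> I \<Longrightarrow> f + g \<in> I"
    "f \<in> I \<Longrightarrow> supported h \<Longrightarrow> h * f \<in> I" using I by blast+
  then show "f \<in> I \<Longrightarrow> supported h \<Longrightarrow> f * h \<in> I" by (simp add: mult.commute)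
  assume fg: "f \<in> I" "g \<in> I"
  then have "(- 1) * g \<in> I" using I by (meson supported_1 supported_uminus)
  then have "f + (- 1) * g \<in> I" using I fg by blast
  then show "f - g \<in> I" by simp
qed

lemma primeideal_iff:
  fixes I :: "((real \<times> real) \<Rightarrow>\<^sub>0 'k::field) set"
  shows "primeideal I (semigroup_ring S) \<longleftrightarrow> ideal I (semigroup_ring S) \<and> 1 \<notin> I \<and>
    (\<forall>f g. supported f \<longrightarrow> supported g \<longrightarrow> f * g \<in> I \<longrightarrow> f \<in> I \<or> g \<in> I)" (is "?L \<longleftrightarrow> ?R")
proof
  assume ?L
  then interpret I: primeideal I "semigroup_ring S" .
  show ?R using I.is_ideal I.I_prime I.I_notcarr I.one_imp_carrier by auto
next
  assume R: ?R
  show ?L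
  proof (rule primeidealI)
    show "carrier (semigroup_ring S) \<noteq> I" using R R.one_closed by force
  qed (use R R.is_cring in auto)
qed

lemma primeidealD:
  fixes I :: "((real \<times> real) \<Rightarrow>\<^sub>0 'k::field) set"
  assumes "primeideal I (semigroup_ring S)"
  shows "ideal I (semigroup_ring S)" "1 \<notin> I"
    "f * g \<in> I \<Longrightarrow> supported f \<Longrightarrow> supported g \<Longrightarrow> f \<in> I \<or> g \<in> I"
  using assms unfolding primeideal_iff by blast+

lemma const_notin_primeideal:
  fixes I :: "((real \<times> real) \<Rightarrow>\<^sub>0 'k::field) set"
  assumes "primeideal I (semigroup_ring S)" "c \<noteq> 0"
  shows "Poly_Mapping.single 0 c \<notin> I"
proof
  assume "Poly_Mapping.single 0 c \<in> I"
  then have "Poly_Mapping.single 0 (inverse c) * Poly_Mapping.single 0 c \<in> I"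
    using idealD(4)[OF primeidealD(1)[OF assms(1)]] by simp
  then show False using primeidealD(2)[OF assms(1)] assms(2) by (simp add: mult_single)
qed

lemma genideal_empty: "genideal (semigroup_ring S) {} = {0 :: (real \<times> real) \<Rightarrow>\<^sub>0 'k::field}"
proof -
  have "ideal {0 :: (real \<times> real) \<Rightarrow>\<^sub>0 'k} (semigroup_ring S)" by (simp add: ideal_iff)
  then have "genideal (semigroup_ring S) {} \<subseteq> {0 :: (real \<times> real) \<Rightarrow>\<^sub>0 'k}"
    by (intro R.genideal_minimal) auto
  moreover have "0 \<in> genideal (semigroup_ring S) ({} :: ((real \<times> real) \<Rightarrow>\<^sub>0 'k) set)"
    using idealD(2)[OF R.genideal_ideal[of "{}"]] by blast
  ultimately show ?thesis by blast
qed

lemma genideal_singleton: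
  fixes f :: "(real \<times> real) \<Rightarrow>\<^sub>0 'k::field"
  assumes "supported f"
  shows "genideal (semigroup_ring S) {f} = {f * h |h. supported h}"
  using R.cgenideal_eq_genideal[of f] assms
  by (auto simp: cgenideal_def mult.commute)

text \<open>
  The quotient by this ideal is the semigroup ring of the face, which is a domain: in a product of
  two elements that both have exponents in \<open>F\<close>, the leading exponents within \<open>F\<close> produce a
  term that nothing else can cancel.
\<close>

lemma face_primeideal:
  assumes F: "F \<subseteq> S" "0 \<in> F" and face: "\<And>x y. x \<in> S \<Longrightarrow> y \<in> S \<Longrightarrow> x + y \<in> F \<longleftrightarrow> x \<in> F \<and> y \<in> F"
  shows "primeideal {f :: (real \<times> real) \<Rightarrow>\<^sub>0 'k::field. supported f \<and> Poly_Mapping.keys f \<inter> F = {}}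
    (semigroup_ring S)" (is "primeideal ?Q _")
  unfolding primeideal_iff
proof (intro conjI allI impI)
  show "ideal ?Q (semigroup_ring S)"
    unfolding ideal_iff
  proof (intro conjI ballI allI impI)
    fix f g assume "f \<in> ?Q" "g \<in> ?Q"
    then show "f + g \<in> ?Q" using keys_add[of f g] supported_add by auto
  next
    fix f h :: "(real \<times> real) \<Rightarrow>\<^sub>0 'k"
    assume f: "f \<in> ?Q" and h: "supported h"
    then have "a + b \<notin> F" if "a \<in> Poly_Mapping.keys h" "b \<in> Poly_Mapping.keys f" for a b
      using face[of a b] that by (auto simp: supported_def)
    then have "Poly_Mapping.keys (h * f) \<inter> F = {}" using keys_mult[of h f] by fastforce
    then show "h * f \<in> ?Q" using f h supported_times by blast
  qed auto
  show "1 \<notin> ?Q" using F by simp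
  fix f g :: "(real \<times> real) \<Rightarrow>\<^sub>0 'k"
  assume f: "supported f" and g: "supported g" and fg: "f * g \<in> ?Q"
  show "f \<in> ?Q \<or> g \<in> ?Q"
  proof (rule ccontr)
    assume "\<not> (f \<in> ?Q \<or> g \<in> ?Q)"
    then have ne: "Poly_Mapping.keys f \<inter> F \<noteq> {}" "Poly_Mapping.keys g \<inter> F \<noteq> {}"
      using f g by auto
    obtain \<alpha> where \<alpha>: "\<alpha> \<in> Poly_Mapping.keys f \<inter> F"
      "\<And>a. a \<in> Poly_Mapping.keys f \<inter> F \<Longrightarrow> a \<noteq> \<alpha> \<Longrightarrow> lex_less a \<alpha>"
      using ex_lex_greatest[OF finite_Int[OF disjI1, OF finite_keys] ne(1)] by blast
    obtain \<beta> where \<beta>: "\<beta> \<in> Poly_Mapping.keys g \<inter> F"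
      "\<And>a. a \<in> Poly_Mapping.keys g \<inter> F \<Longrightarrow> a \<noteq> \<beta> \<Longrightarrow> lex_less a \<beta>"
      using ex_lex_greatest[OF finite_Int[OF disjI1, OF finite_keys] ne(2)] by blast
    have sum: "\<alpha> + \<beta> \<in> F" using face[of \<alpha> \<beta>] \<alpha> \<beta> F by blast
    have "Poly_Mapping.lookup (f * g) (\<alpha> + \<beta>) = Poly_Mapping.lookup f \<alpha> * Poly_Mapping.lookup g \<beta>"
    proof (rule lookup_times_unique)
      fix a b assume ab: "a \<in> Poly_Mapping.keys f" "b \<in> Poly_Mapping.keys g" "a + b = \<alpha> + \<beta>"
      then have "a \<in> F" "b \<in> F" using face[of a b] sum f g by (auto simp: supported_def)
      then show "a = \<alpha>" using ab \<alpha>(2) \<beta>(2) by (intro lex_greatest_unique_sum[of a \<alpha> b \<beta>]) auto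
    qed
    then have "\<alpha> + \<beta> \<in> Poly_Mapping.keys (f * g)" using \<alpha>(1) \<beta>(1) by (simp add: in_keys_iff)
    then show False using fg sum by blast
  qed
qed

end

section \<open>Saturation and regular sequences of length two\<close>

context plane_monoid begin

lemma scale_in: "a \<in> S \<Longrightarrow> real k *\<^sub>R a \<in> S"
proof (induction k)
  case (Suc k)
  then have "a + real k *\<^sub>R a \<in> S" by (intro add_in)
  then show ?case by (simp add: scaleR_left_distrib)
qed (simp add: zero_in)

lemma degree_nat:
  assumes "e \<in> S" shows "\<exists>m::nat. fst e + snd e = real m"
proof -
  obtain i j where "fst e = of_nat i" "snd e = of_nat j"
    using assms nat by (auto elim!: Nats_cases)
  then show ?thesis by (intro exI[of _ "i + j"]) simp
qed

lemma nonneg: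
  assumes "e \<in> S" shows "0 \<le> fst e" "0 \<le> snd e"
proof -
  have "fst e \<in> \<nat>" "snd e \<in> \<nat>" using assms nat by auto
  then show "0 \<le> fst e" "0 \<le> snd e" by (auto elim!: Nats_cases)
qed

lemma degree_ge_1:
  assumes "e \<in> S" "e \<noteq> 0" shows "1 \<le> fst e + snd e"
proof -
  obtain m where m: "fst e + snd e = real m" using degree_nat assms by blast
  have "m \<noteq> 0" using m nonneg[OF assms(1)] assms(2) by (auto simp: prod_eq_iff)
  then show ?thesis using m by simp
qed

lemma regular_pair_iff:
  fixes f g :: "(real \<times> real) \<Rightarrow>\<^sub>0 'k::field"
  shows "regular_sequence (semigroup_ring S) [f, g] \<longleftrightarrow>
    supported f \<and> supported g \<and> genideal (semigroup_ring S) {f, g} \<noteq> carrier (semigroup_ring S) \<and>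
    (\<forall>y. supported y \<longrightarrow> f * y = 0 \<longrightarrow> y = 0) \<and>
    (\<forall>y. supported y \<longrightarrow> (\<exists>h. g * y = f * h \<and> supported h) \<longrightarrow> (\<exists>h. y = f * h \<and> supported h))"
proof (cases "supported f")
  case True
  have pair: "(\<forall>i<length [f, g]. P i) \<longleftrightarrow> P 0 \<and> P 1" for P
    by (auto simp: less_Suc_eq)
  show ?thesis
    unfolding regular_sequence_def pair
    by (simp add: genideal_empty genideal_singleton[OF True] Ball_def)
qed (simp add: regular_sequence_def)

lemma keys_times_degree:
  fixes f g :: "(real \<times> real) \<Rightarrow>\<^sub>0 'k::field"
  assumes "\<forall>e\<in>Poly_Mapping.keys f. a \<le> fst e + snd e" "\<forall>e\<in>Poly_Mapping.keys g. b \<le> fst e + snd e"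
  shows "\<forall>e\<in>Poly_Mapping.keys (f * g). a + b \<le> fst e + snd e"
proof
  fix e assume "e \<in> Poly_Mapping.keys (f * g)"
  then obtain x y where "x \<in> Poly_Mapping.keys f" "y \<in> Poly_Mapping.keys g" "e = x + y"
    using keys_mult by blast
  then show "a + b \<le> fst e + snd e" using assms by fastforce
qed

text \<open>
  Nonzero elements of \<open>S\<close> have coordinate sum at least 1, because coordinates are natural numbers.
\<close>

lemma keys_power_degree:
  fixes f :: "(real \<times> real) \<Rightarrow>\<^sub>0 'k::field"
  assumes "supported f" "0 \<notin> Poly_Mapping.keys f"
  shows "\<forall>e\<in>Poly_Mapping.keys (f ^ i). real i \<le> fst e + snd e"
proof (induction i)
  case (Suc i)
  have "\<forall>e\<in>Poly_Mapping.keys f. 1 \<le> fst e + snd e"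
    using assms degree_ge_1 unfolding supported_def by (metis subsetD)
  from keys_times_degree[OF this Suc] show ?case by (simp add: add.commute)
qed simp

text \<open>
  The elementary form of the vanishing of the zeroth and first local cohomology at depth two: the
  conditions \<open>f m \<in> K[S]\<close> and \<open>g m \<in> K[S]\<close> force \<open>m \<in> K[S]\<close>, as \<open>g (f m) = f (g m)\<close> and \<open>g\<close> is
  regular modulo \<open>f\<close>. This is applied to \<open>m = f^i g^j x^z\<close>, starting from large \<open>i + j\<close>.
\<close>

lemma regular_pair_imp_saturated:
  fixes f g :: "(real \<times> real) \<Rightarrow>\<^sub>0 'k::field"
  assumes reg: "regular_sequence (semigroup_ring S) [f, g]"
    and 0: "0 \<notin> Poly_Mapping.keys f" "0 \<notin> Poly_Mapping.keys g"
    and D: "\<And>s. s \<in> S \<Longrightarrow> real D \<le> fst s + snd s \<Longrightarrow> s - u \<in> S \<or> s - v \<in> S"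
    and z: "z + u \<in> S" "z + v \<in> S"
  shows "z \<in> S"
proof -
  have f: "supported f" and g: "supported g" using reg by (auto simp: regular_pair_iff)
  have f0: "f \<noteq> 0"
  proof
    assume "f = 0"
    moreover have "\<forall>y. supported y \<longrightarrow> f * y = 0 \<longrightarrow> y = 0"
      using reg unfolding regular_pair_iff by blast
    ultimately have "(1 :: (real \<times> real) \<Rightarrow>\<^sub>0 'k) = 0" using supported_1 by (metis mult_zero_left)
    then show False by simp
  qed
  have descend: "supported m" if m: "supported (f * m)" "supported (g * m)" for m
  proof -
    have "g * (f * m) = f * (g * m)" by (simp add: mult_ac)
    then have "\<exists>h. g * (f * m) = f * h \<and> supported h" using m(2) by blast
    moreover have "\<forall>y. supported y \<longrightarrow> (\<exists>h. g * y = f * h \<and> supported h) \<longrightarrow> (\<exists>h. y = f * h \<and> supported h)"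
      using reg unfolding regular_pair_iff by blast
    ultimately obtain h where "supported h" "f * m = f * h" using m(1) by blast
    then show ?thesis using plane_times_cancel[OF _ f0] by blast
  qed
  let ?x = "Poly_Mapping.single z (1::'k)"
  have base: "supported (f ^ i * g ^ j * ?x)" if "D \<le> i + j" for i j
  proof -
    have sup: "supported (f ^ i * g ^ j)" using f g by (intro supported_times supported_power)
    have "e + z \<in> S" if e: "e \<in> Poly_Mapping.keys (f ^ i * g ^ j)" for e
    proof -
      have "real i + real j \<le> fst e + snd e"
        using keys_times_degree[OF keys_power_degree[OF f 0(1)] keys_power_degree[OF g 0(2)]] e
        by blast
      then consider "e - u \<in> S" | "e - v \<in> S"
        using D[of e] e sup \<open>D \<le> i + j\<close> by (fastforce simp: supported_def)
      then show ?thesis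
      proof cases
        case 1 then show ?thesis using add_in[OF 1 z(1)] by (simp add: algebra_simps)
      next
        case 2 then show ?thesis using add_in[OF 2 z(2)] by (simp add: algebra_simps)
      qed
    qed
    moreover have "Poly_Mapping.keys (f ^ i * g ^ j * ?x)
        \<subseteq> {e + z |e. e \<in> Poly_Mapping.keys (f ^ i * g ^ j)}"
      using keys_mult[of "f ^ i * g ^ j" ?x] by auto
    ultimately show ?thesis by (auto simp: supported_def)
  qed
  have "\<forall>i j. D \<le> i + j + k \<longrightarrow> supported (f ^ i * g ^ j * ?x)" for k
  proof (induction k)
    case 0
    then show ?case using base by simp
  next
    case (Suc k)
    show ?case
    proof (intro allI impI)
      fix i j assume "D \<le> i + j + Suc k"
      then have *: "D \<le> Suc i + j + k" "D \<le> i + Suc j + k" by simp_all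
      show "supported (f ^ i * g ^ j * ?x)"
      proof (rule descend)
        show "supported (f * (f ^ i * g ^ j * ?x))"
          using Suc[rule_format, OF *(1)] by (simp only: power_Suc mult.assoc)
        show "supported (g * (f ^ i * g ^ j * ?x))"
          using Suc[rule_format, OF *(2)] by (simp only: power_Suc mult_ac)
      qed
    qed
  qed
  from this[of D, THEN spec, of 0, THEN spec, of 0] show ?thesis by (simp add: supported_def)
qed

text \<open>
  An ideal that is properly larger contains an element with nonzero constant term; removing its other
  terms leaves a unit.
\<close>

lemma origin_maximalideal:
  "maximalideal {f :: (real \<times> real) \<Rightarrow>\<^sub>0 'k::field. supported f \<and> 0 \<notin> Poly_Mapping.keys f}
    (semigroup_ring S)" (is "maximalideal ?P _")
  and origin_primeideal:
  "primeideal {f :: (real \<times> real) \<Rightarrow>\<^sub>0 'k::field. supported f \<and> 0 \<notin> Poly_Mapping.keys f}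
    (semigroup_ring S)"
proof -
  have "x + y \<in> {0} \<longleftrightarrow> x \<in> {0} \<and> y \<in> {0}" if "x \<in> S" "y \<in> S" for x y
    using nonneg[OF that(1)] nonneg[OF that(2)] by (auto simp: prod_eq_iff)
  from face_primeideal[OF _ _ this] show prime: "primeideal ?P (semigroup_ring S)"
    using zero_in by simp
  show "maximalideal ?P (semigroup_ring S)"
  proof (rule maximalidealI[OF primeidealD(1)[OF prime]])
    show "carrier (semigroup_ring S) \<noteq> ?P"
      using primeidealD(2)[OF prime] by (metis semigroup_ring_simps(1) supported_1)
    fix J :: "((real \<times> real) \<Rightarrow>\<^sub>0 'k) set"
    assume J: "ideal J (semigroup_ring S)" "?P \<subseteq> J" "J \<subseteq> carrier (semigroup_ring S)"
    show "J = ?P \<or> J = carrier (semigroup_ring S)"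
    proof (cases "J \<subseteq> ?P")
      case False
      then obtain f where f: "f \<in> J" "f \<notin> ?P" by blast
      note sf = idealD(1)[OF J(1) f(1)]
      let ?c = "Poly_Mapping.lookup f 0"
      have c: "?c \<noteq> 0" using f sf by (simp add: in_keys_iff)
      have "f - Poly_Mapping.single 0 ?c \<in> ?P"
        using sf supported_diff[OF sf supported_const] by (auto simp: in_keys_iff lookup_minus)
      then have "f - (f - Poly_Mapping.single 0 ?c) \<in> J"
        using J(2) idealD(6)[OF J(1) f(1)] by blast
      then have "Poly_Mapping.single 0 (inverse ?c) * Poly_Mapping.single 0 ?c \<in> J"
        using idealD(4)[OF J(1)] by simp
      then have "1 \<in> J" using c by (simp add: mult_single)
      then have "h \<in> J" if "supported h" for h using idealD(4)[OF J(1) _ that] by fastforce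
      then show ?thesis using J(3) by auto
    qed (use J in blast)
  qed
qed

text \<open>
  The faces \<open>S\<close>, \<open>F\<close> and \<open>{0}\<close> give a chain of primes of length two below the ideal of the origin, so
  a Cohen-Macaulay ring has a regular pair in that ideal.
\<close>

lemma cohen_macaulay_imp_saturated:
  fixes K :: "'k::field itself"
  assumes cm: "cohen_macaulay_semigroup K S"
    and F: "F \<subseteq> S" "0 \<in> F" "F \<noteq> {0}" "F \<noteq> S"
    and face: "\<And>x y. x \<in> S \<Longrightarrow> y \<in> S \<Longrightarrow> x + y \<in> F \<longleftrightarrow> x \<in> F \<and> y \<in> F"
    and D: "\<And>s. s \<in> S \<Longrightarrow> real D \<le> fst s + snd s \<Longrightarrow> s - u \<in> S \<or> s - v \<in> S"
    and z: "z + u \<in> S" "z + v \<in> S"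
  shows "z \<in> S"
proof -
  let ?R = "semigroup_ring S :: ((real \<times> real) \<Rightarrow>\<^sub>0 'k) ring"
  let ?Q = "\<lambda>G. {f :: (real \<times> real) \<Rightarrow>\<^sub>0 'k. supported f \<and> Poly_Mapping.keys f \<inter> G = {}}"
  let ?P = "{f :: (real \<times> real) \<Rightarrow>\<^sub>0 'k. supported f \<and> 0 \<notin> Poly_Mapping.keys f}"
  define C where "C = (\<lambda>i::nat. if i = 0 then ?Q S else if i = 1 then ?Q F else ?P)"
  have strict: "?Q G' \<subset> ?Q G" if "G \<subseteq> G'" "x \<in> G'" "x \<notin> G" "G' \<subseteq> S" for G G' x
  proof -
    have "Poly_Mapping.single x (1::'k) \<in> ?Q G - ?Q G'"
      using that by (auto simp: supported_def)
    then show ?thesis using that(1) by blast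
  qed
  obtain x y where x: "x \<in> S" "x \<notin> F" and y: "y \<in> F" "y \<notin> {0}" using F by blast
  have P: "?P = ?Q {0}" by auto
  have chain: "\<forall>i<2. C i \<subset> C (Suc i)"
  proof (intro allI impI)
    fix i :: nat assume "i < 2"
    then consider "i = 0" | "i = 1" by fastforce
    then show "C i \<subset> C (Suc i)"
    proof cases
      case 1 then show ?thesis using strict[OF F(1) x] by (simp add: C_def)
    next
      case 2 then show ?thesis using strict[OF _ y F(1)] F(2) unfolding C_def P by simp
    qed
  qed
  have "primeideal (?Q S) ?R" "primeideal (?Q F) ?R" "primeideal ?P ?R"
    by (rule face_primeideal origin_primeideal F face | use zero_in add_in in blast)+
  then have prime: "\<forall>i\<le>2. primeideal (C i) ?R" by (simp add: C_def)
  have "C 2 = ?P" by (simp add: C_def)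
  then have "enat 2 \<le> prime_height ?R ?P"
    unfolding prime_height_def using prime chain by (intro Sup_upper) blast
  then have depth: "enat 2 \<le> ideal_depth ?R ?P"
    using cm origin_maximalideal unfolding cohen_macaulay_semigroup_def cohen_macaulay_ring_def by metis
  have "\<exists>xs. regular_sequence ?R xs \<and> set xs \<subseteq> ?P \<and> 2 \<le> length xs"
  proof (rule ccontr)
    assume "\<not> ?thesis"
    then have "ideal_depth ?R ?P \<le> enat 1"
      unfolding ideal_depth_def by (intro Sup_least) (auto simp: not_le)
    then have "enat 2 \<le> enat 1" using order_trans[OF depth] by blast
    then show False by (simp only: enat_ord_simps)
  qed
  then obtain xs where xs: "regular_sequence ?R xs" "set xs \<subseteq> ?P" "2 \<le> length xs" by blast
  then obtain f g ys where fg: "xs = f # g # ys" by (metis Suc_le_length_iff numeral_2_eq_2)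
  have sup: "set [f, g] \<subseteq> carrier ?R" "set xs \<subseteq> carrier ?R"
    using xs fg by (auto simp: regular_sequence_def)
  have "genideal ?R {f, g} \<noteq> carrier ?R"
  proof
    assume *: "genideal ?R {f, g} = carrier ?R"
    have "genideal ?R {f, g} \<subseteq> ?P"
      using xs(2) fg by (intro R.genideal_minimal primeidealD(1)[OF origin_primeideal]) auto
    then show False using * primeidealD(2)[OF origin_primeideal] R.one_closed by auto
  qed
  moreover have "[f, g] ! i \<otimes>\<^bsub>?R\<^esub> y \<in> genideal ?R (set (take i [f, g])) \<longrightarrow>
      y \<in> genideal ?R (set (take i [f, g]))" if i: "i < length [f, g]" and y: "y \<in> carrier ?R" for i y
  proof -
    have "xs ! i = [f, g] ! i" "take i xs = take i [f, g]" "i < length xs"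
      using i unfolding fg by (cases i; auto)+
    then show ?thesis using xs(1) y unfolding regular_sequence_def by metis
  qed
  ultimately have "regular_sequence ?R [f, g]" using sup(1) unfolding regular_sequence_def by simp
  moreover have "0 \<notin> Poly_Mapping.keys f" "0 \<notin> Poly_Mapping.keys g" using xs(2) fg by auto
  ultimately show ?thesis using regular_pair_imp_saturated D z by blast
qed

lemma saturated_iterate:
  assumes sat: "\<And>z. z + u \<in> S \<Longrightarrow> z + v \<in> S \<Longrightarrow> z \<in> S"
    and uv: "u \<in> S" "v \<in> S" and z: "z + real i *\<^sub>R u \<in> S" "z + real j *\<^sub>R v \<in> S"
  shows "z \<in> S"
proof -
  have one: "z + u \<in> S \<Longrightarrow> z + real j *\<^sub>R v \<in> S \<Longrightarrow> z \<in> S" for z j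
  proof (induction j)
    case (Suc j)
    have "z + real j *\<^sub>R v + u \<in> S"
      using add_in[OF Suc.prems(1) scale_in[OF uv(2), of j]] by (simp add: algebra_simps)
    moreover have "z + real j *\<^sub>R v + v \<in> S" using Suc.prems(2) by (simp add: algebra_simps)
    ultimately show ?case using Suc.IH Suc.prems(1) sat by blast
  qed simp
  show ?thesis using z(1)
  proof (induction i)
    case (Suc i)
    have "z + real i *\<^sub>R u + u \<in> S" using Suc.prems by (simp add: algebra_simps)
    moreover have "z + real i *\<^sub>R u + real j *\<^sub>R v \<in> S"
      using add_in[OF z(2) scale_in[OF uv(1), of i]] by (simp add: algebra_simps)
    ultimately show ?case using Suc.IH one by blast
  qed simp
qed

text \<open>
  A polynomial of formal degree \<open>d\<close> in the monomial \<open>x^u\<close>.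
\<close>

definition ray_poly :: "real \<times> real \<Rightarrow> nat \<Rightarrow> (nat \<Rightarrow> 'k::field) \<Rightarrow> (real \<times> real) \<Rightarrow>\<^sub>0 'k" where
  "ray_poly u d c = (\<Sum>k\<le>d. Poly_Mapping.single (real k *\<^sub>R u) (c k))"

lemma supported_ray_poly: "u \<in> S \<Longrightarrow> supported (ray_poly u d c)"
  unfolding ray_poly_def by (intro supported_sum supported_single scale_in)

lemma keys_ray_poly: "Poly_Mapping.keys (ray_poly u d c) \<subseteq> (\<lambda>k. real k *\<^sub>R u) ` {..d}"
  unfolding ray_poly_def by (intro keys_sum_subset) auto

lemma lookup_ray_poly_top: "u \<noteq> 0 \<Longrightarrow> Poly_Mapping.lookup (ray_poly u d c) (real d *\<^sub>R u) = c d"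
  by (simp add: ray_poly_def lookup_sum lookup_single when_def)

text \<open>
  Division with remainder by a polynomial in \<open>x^u\<close> with leading coefficient \<open>c d\<close>. A monomial whose
  exponent stays in \<open>S\<close> after subtracting \<open>d u\<close> is replaced by monomials of smaller coordinate sum,
  and so on until only exponents are left for which this is impossible.
\<close>

lemma ray_poly_division:
  fixes c :: "nat \<Rightarrow> 'k::field"
  assumes u: "u \<in> S" "u \<noteq> 0" and cd: "c d \<noteq> 0" and y: "supported y"
  shows "\<exists>h r. supported h \<and> Poly_Mapping.keys r \<subseteq> {e \<in> S. e - real d *\<^sub>R u \<notin> S} \<and>
    y = ray_poly u d c * h + r"
proof -
  let ?p = "ray_poly u d c"
  let ?B = "{e \<in> S. e - real d *\<^sub>R u \<notin> S}"
  define Dv where "Dv y \<longleftrightarrow> (\<exists>h r. supported h \<and> Poly_Mapping.keys r \<subseteq> ?B \<and> y = ?p * h + r)" for y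
  have Dv_add: "Dv (y + y')" if yy: "Dv y" "Dv y'" for y y'
  proof -
    obtain h r h' r' where "supported h" "Poly_Mapping.keys r \<subseteq> ?B" "y = ?p * h + r"
      "supported h'" "Poly_Mapping.keys r' \<subseteq> ?B" "y' = ?p * h' + r'"
      using yy unfolding Dv_def by blast
    moreover have "Poly_Mapping.keys (r + r') \<subseteq> ?B" using keys_add[of r r'] calculation by blast
    ultimately show ?thesis unfolding Dv_def
      by (intro exI[of _ "h + h'"] exI[of _ "r + r'"]) (auto simp: algebra_simps supported_add)
  qed
  have Dv_multiple: "Dv (?p * h)" if "supported h" for h
    unfolding Dv_def using that by (intro exI[of _ h] exI[of _ 0]) simp
  have Dv_sum: "Dv (sum Y I)" if "\<And>i. i \<in> I \<Longrightarrow> Dv (Y i)" for Y and I :: "'i set"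
    using that by (induction I rule: infinite_finite_induct)
      (use Dv_multiple[of 0] Dv_add in auto)
  have Dv_single: "\<forall>e a. e \<in> S \<longrightarrow> fst e + snd e = real m \<longrightarrow> Dv (Poly_Mapping.single e a)" for m
  proof (induction m rule: less_induct)
    case (less m)
    show ?case
    proof (intro allI impI)
      fix e a assume e: "e \<in> S" "fst e + snd e = real m"
      show "Dv (Poly_Mapping.single e a)"
      proof (cases "e \<in> ?B")
        case True
        then show ?thesis unfolding Dv_def
          by (intro exI[of _ 0] exI[of _ "Poly_Mapping.single e a"]) simp
      next
        case False
        \<comment> \<open>Subtracting \<open>(a / c d) x^e' p\<close> cancels the term at \<open>e\<close>.\<close>
        define e' where "e' = e - real d *\<^sub>R u"
        have e': "e' \<in> S" using False e by (simp add: e'_def)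
        define b where "b = a / c d"
        let ?s = "\<lambda>k. Poly_Mapping.single (real k *\<^sub>R u + e') (c k * b)"
        have "?p * Poly_Mapping.single e' b = (\<Sum>k\<le>d. ?s k)"
          by (simp add: ray_poly_def sum_distrib_right mult_single)
        also have "\<dots> = (\<Sum>k<d. ?s k) + Poly_Mapping.single e a"
          using cd by (simp add: lessThan_Suc_atMost[symmetric] b_def e'_def)
        finally have eq: "Poly_Mapping.single e a
            = ?p * Poly_Mapping.single e' b + (\<Sum>k<d. Poly_Mapping.single (real k *\<^sub>R u + e') (- (c k * b)))"
          by (simp add: single_uminus sum_negf)
        have "Dv (Poly_Mapping.single (real k *\<^sub>R u + e') x)" if k: "k < d" for k x
        proof -
          have S: "real k *\<^sub>R u + e' \<in> S" using e' scale_in[OF u(1)] add_in by blast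
          then obtain n where n: "fst (real k *\<^sub>R u + e') + snd (real k *\<^sub>R u + e') = real n"
            using degree_nat by blast
          have "fst (real k *\<^sub>R u + e') + snd (real k *\<^sub>R u + e')
              = real m - (real d - real k) * (fst u + snd u)"
            using e(2) by (simp add: e'_def algebra_simps)
          moreover have "(real d - real k) * (fst u + snd u) > 0"
            using k degree_ge_1[OF u] by simp
          ultimately have "n < m" using n by simp
          then show ?thesis using less S n by blast
        qed
        then show ?thesis unfolding eq using e' by (intro Dv_add Dv_multiple Dv_sum supported_single) auto
      qed
    qed
  qed
  have "Dv y"
  proof (subst sum_monomials[of y, symmetric], rule Dv_sum)
    fix e assume "e \<in> Poly_Mapping.keys y"
    then have "e \<in> S" using y by (auto simp: supported_def)
    then show "Dv (Poly_Mapping.single e (Poly_Mapping.lookup y e))"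
      using Dv_single degree_nat by blast
  qed
  then show ?thesis by (simp add: Dv_def)
qed

text \<open>
  Let \<open>B\<close> be the set of exponents of remainders of division by \<open>p = ray_poly u d c\<close>. Saturation
  gives \<open>B + v \<subseteq> B\<close>. Hence if \<open>y = p h + r\<close>, then \<open>q r\<close> is a multiple of \<open>p\<close> with
  exponents in \<open>B\<close> only. A nonzero multiple of \<open>p\<close> has its leading exponent in \<open>d u + S\<close>, which is
  disjoint from \<open>B\<close>; so \<open>q r = 0\<close> and \<open>r = 0\<close>.
\<close>

lemma saturated_imp_regular:
  fixes c :: "nat \<Rightarrow> 'k::field"
  assumes sat: "\<And>z. z + u \<in> S \<Longrightarrow> z + v \<in> S \<Longrightarrow> z \<in> S"
    and u: "u \<in> S" "u \<noteq> 0" and v: "v \<in> S" "v \<noteq> 0"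
    and cd: "c d \<noteq> 0" and bd: "b m \<noteq> 0" and y: "supported y" and w: "supported w"
    and eq: "ray_poly v m b * y = ray_poly u d c * w"
  shows "\<exists>h. supported h \<and> y = ray_poly u d c * h"
proof -
  let ?p = "ray_poly u d c" and ?q = "ray_poly v m b"
  let ?B = "{e \<in> S. e - real d *\<^sub>R u \<notin> S}"
  obtain h r where hr: "supported h" "Poly_Mapping.keys r \<subseteq> ?B" "y = ?p * h + r"
    using ray_poly_division[where c = c and d = d, OF u cd y] by blast
  define w' where "w' = w - ?q * h"
  have qr: "?q * r = ?p * w'" using eq by (simp add: w'_def hr(3) algebra_simps)
  have sw': "supported w'" unfolding w'_def using w hr(1) supported_ray_poly[OF v(1)] supported_diff supported_times by blast
  have B: "Poly_Mapping.keys (?q * r) \<subseteq> ?B"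
  proof
    fix e assume "e \<in> Poly_Mapping.keys (?q * r)"
    then obtain k x where kx: "x \<in> ?B" "e = real k *\<^sub>R v + x"
      using keys_mult[of ?q r] keys_ray_poly[of v m b] hr(2) by blast
    have "x - real d *\<^sub>R u \<in> S" if "e - real d *\<^sub>R u \<in> S"
      using saturated_iterate[OF sat u(1) v(1), of "x - real d *\<^sub>R u" d k] that kx
      by (simp add: algebra_simps)
    moreover have "e \<in> S" using kx scale_in[OF v(1)] add_in by blast
    ultimately show "e \<in> ?B" using kx by blast
  qed
  have "w' = 0"
  proof (rule ccontr)
    assume "w' \<noteq> 0"
    then have "Poly_Mapping.keys w' \<noteq> {}" by (auto simp: poly_mapping_eq_iff fun_eq_iff in_keys_iff)
    then obtain \<beta> where \<beta>: "\<beta> \<in> Poly_Mapping.keys w'"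
      "\<And>a. a \<in> Poly_Mapping.keys w' \<Longrightarrow> a \<noteq> \<beta> \<Longrightarrow> lex_less a \<beta>"
      using ex_lex_greatest[OF finite_keys] by blast
    have top: "lex_less a (real d *\<^sub>R u)" if a: "a \<in> Poly_Mapping.keys ?p" "a \<noteq> real d *\<^sub>R u" for a
    proof -
      obtain k where k: "a = real k *\<^sub>R u" "k \<le> d" using keys_ray_poly[of u d c] a(1) by blast
      then have "k < d" using a(2) by (cases "k = d") auto
      moreover have "fst u > 0 \<or> fst u = 0 \<and> snd u > 0"
        using nonneg[OF u(1)] u(2) by (auto simp: prod_eq_iff)
      ultimately show ?thesis using k by (auto simp: lex_less_def)
    qed
    have "Poly_Mapping.lookup (?p * w') (real d *\<^sub>R u + \<beta>)
        = Poly_Mapping.lookup ?p (real d *\<^sub>R u) * Poly_Mapping.lookup w' \<beta>"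
      by (rule lookup_times_unique) (rule lex_greatest_unique_sum, use top \<beta> in auto)
    also have "\<dots> \<noteq> 0" using \<beta>(1) cd lookup_ray_poly_top[OF u(2), of d c] by (simp add: in_keys_iff)
    finally have "real d *\<^sub>R u + \<beta> \<in> ?B" using B qr by (auto simp: in_keys_iff)
    then show False using \<beta>(1) sw' by (auto simp: supported_def)
  qed
  then have "?q * r = 0" using qr by simp
  moreover have "?q \<noteq> 0" using lookup_ray_poly_top[OF v(2), of m b] bd by auto
  ultimately have "r = 0" by (simp add: plane_times_eq_0_iff)
  then show ?thesis using hr by auto
qed

end

section \<open>Algebraic dependence and the dimension bound\<close>

text \<open>
  Gaussian elimination: an equation with a nonzero coefficient is solved for one unknown, which
  removes one equation and one unknown.
\<close>

lemma underdetermined_system: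
  fixes M :: "'e \<Rightarrow> 'i \<Rightarrow> 'k::field"
  assumes "finite E" "finite I" "card E < card I"
  shows "\<exists>c. (\<exists>i\<in>I. c i \<noteq> 0) \<and> (\<forall>e\<in>E. (\<Sum>i\<in>I. M e i * c i) = 0)"
  using assms
proof (induction E arbitrary: M I rule: finite_induct)
  case empty
  then obtain i where "i \<in> I" by (metis card.empty equals0I less_irrefl)
  then show ?case by (intro exI[of _ "\<lambda>_. 1"]) auto
next
  case (insert e E)
  show ?case
  proof (cases "\<forall>i\<in>I. M e i = 0")
    case True
    obtain c where "\<exists>i\<in>I. c i \<noteq> 0" "\<forall>e\<in>E. (\<Sum>i\<in>I. M e i * c i) = 0"
      using insert.IH[of I M] insert.prems insert.hyps by auto
    then show ?thesis using True by (intro exI[of _ c]) auto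
  next
    case False
    then obtain j where j: "j \<in> I" "M e j \<noteq> 0" by blast
    let ?I = "I - {j}"
    define M' where "M' f i = M f i - M f j * M e i / M e j" for f i
    have "card E < card ?I" using insert.prems insert.hyps j by simp
    then obtain c where c: "\<exists>i\<in>?I. c i \<noteq> 0" "\<forall>f\<in>E. (\<Sum>i\<in>?I. M' f i * c i) = 0"
      using insert.IH[of ?I M'] insert.prems by auto
    \<comment> \<open>The eliminated unknown is chosen to satisfy the equation \<open>e\<close>.\<close>
    let ?cj = "- (\<Sum>i\<in>?I. M e i * c i) / M e j"
    let ?c = "c(j := ?cj)"
    have split: "(\<Sum>i\<in>I. M f i * ?c i) = M f j * ?cj + (\<Sum>i\<in>?I. M f i * c i)" for f
    proof -
      have "(\<Sum>i\<in>I. M f i * ?c i) = M f j * ?c j + (\<Sum>i\<in>?I. M f i * ?c i)"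
        using insert.prems(1) j(1) by (rule sum.remove)
      also have "(\<Sum>i\<in>?I. M f i * ?c i) = (\<Sum>i\<in>?I. M f i * c i)" by (intro sum.cong) auto
      finally show ?thesis by simp
    qed
    have "(\<Sum>i\<in>I. M f i * ?c i) = 0" if f: "f \<in> E" for f
    proof -
      have "(\<Sum>i\<in>?I. M f i * c i) = (\<Sum>i\<in>?I. M' f i * c i + M f j / M e j * (M e i * c i))"
        by (intro sum.cong) (auto simp: M'_def field_simps)
      also have "\<dots> = M f j / M e j * (\<Sum>i\<in>?I. M e i * c i)"
        using c(2) f by (simp add: sum.distrib sum_distrib_left)
      finally show ?thesis unfolding split by simp
    qed
    moreover have "(\<Sum>i\<in>I. M e i * ?c i) = 0" unfolding split using j(2) by simp
    moreover have "\<exists>i\<in>I. ?c i \<noteq> 0" using c(1) by auto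
    ultimately show ?thesis by blast
  qed
qed

definition nat_box :: "nat \<Rightarrow> (real \<times> real) set" where
  "nat_box m = (\<lambda>(a, b). (real a, real b)) ` ({..m} \<times> {..m})"

lemma finite_nat_box: "finite (nat_box m)" by (simp add: nat_box_def)

lemma card_nat_box_le: "card (nat_box m) \<le> (m + 1) ^ 2"
  unfolding nat_box_def
  by (rule order_trans[OF card_image_le]) (auto simp: card_cartesian_product power2_eq_square)

lemma nat_box_add: "x \<in> nat_box a \<Longrightarrow> y \<in> nat_box b \<Longrightarrow> x + y \<in> nat_box (a + b)"
proof -
  assume "x \<in> nat_box a" "y \<in> nat_box b"
  then obtain i j k l where "x = (real i, real j)" "y = (real k, real l)" "i \<le> a" "j \<le> a" "k \<le> b" "l \<le> b"
    by (auto simp: nat_box_def)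
  then show "x + y \<in> nat_box (a + b)"
    unfolding nat_box_def by (intro image_eqI[of _ _ "(i + k, j + l)"]) auto
qed

lemma nat_box_mono: "a \<le> b \<Longrightarrow> nat_box a \<subseteq> nat_box b"
  unfolding nat_box_def by (intro image_mono) auto

lemma ex_nat_box:
  assumes "finite A" "A \<subseteq> \<nat> \<times> \<nat>"
  shows "\<exists>m. A \<subseteq> nat_box m"
  using assms
proof (induction A rule: finite_induct)
  case (insert x A)
  then obtain m where m: "A \<subseteq> nat_box m" by blast
  obtain a b where "x = (real a, real b)" using insert.prems by (auto elim!: Nats_cases)
  then have "x \<in> nat_box (a + b + m)" by (auto simp: nat_box_def)
  moreover have "A \<subseteq> nat_box (a + b + m)" using m nat_box_mono[of m "a + b + m"] by auto
  ultimately show ?case by blast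
qed auto

lemma keys_times_box:
  assumes "Poly_Mapping.keys f \<subseteq> nat_box a" "Poly_Mapping.keys g \<subseteq> nat_box b"
  shows "Poly_Mapping.keys (f * g) \<subseteq> nat_box (a + b)"
proof
  fix e assume "e \<in> Poly_Mapping.keys (f * g)"
  then obtain x y where "x \<in> Poly_Mapping.keys f" "y \<in> Poly_Mapping.keys g" "e = x + y"
    using keys_mult by blast
  then show "e \<in> nat_box (a + b)" using assms nat_box_add by blast
qed

lemma keys_power_box:
  fixes f :: "(real \<times> real) \<Rightarrow>\<^sub>0 'k::field"
  assumes "Poly_Mapping.keys f \<subseteq> nat_box a"
  shows "Poly_Mapping.keys (f ^ i) \<subseteq> nat_box (i * a)"
proof (induction i)
  case (Suc i)
  from keys_times_box[OF assms Suc] show ?case by simp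
qed (auto simp: nat_box_def zero_prod_def)

context plane_monoid begin

text \<open>
  The products \<open>f0^i f1^j f2^k\<close> with \<open>i, j, k < N\<close> are \<open>N^3\<close> elements of a space of dimension
  \<open>O(N^2)\<close>, since their exponents are lattice points in a square of side \<open>O(N)\<close>. The relation is
  written in nested form because its lowest coefficients are extracted one variable at a time.
\<close>

lemma algebraic_dependence:
  fixes f0 f1 f2 :: "(real \<times> real) \<Rightarrow>\<^sub>0 'k::field"
  assumes sup: "supported f0" "supported f1" "supported f2"
  shows "\<exists>N c. (\<exists>i<N. \<exists>j<N. \<exists>k<N. c i j k \<noteq> 0) \<and>
    (\<Sum>i<N. f0 ^ i * (\<Sum>j<N. f1 ^ j * (\<Sum>k<N. f2 ^ k * Poly_Mapping.single 0 (c i j k)))) = 0"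
proof -
  have "finite (Poly_Mapping.keys f0 \<union> Poly_Mapping.keys f1 \<union> Poly_Mapping.keys f2)" by simp
  moreover have "Poly_Mapping.keys f0 \<union> Poly_Mapping.keys f1 \<union> Poly_Mapping.keys f2 \<subseteq> \<nat> \<times> \<nat>"
    using sup order_trans[OF _ nat] by (simp add: supported_def)
  ultimately obtain D where D: "Poly_Mapping.keys f0 \<subseteq> nat_box D" "Poly_Mapping.keys f1 \<subseteq> nat_box D"
    "Poly_Mapping.keys f2 \<subseteq> nat_box D"
    using ex_nat_box by (metis Un_subset_iff)
  \<comment> \<open>The exponents lie in a square with at most \<open>(3 N D + 1)^2 \<le> N^2 (3 D + 1)^2\<close> points, and the right
    side is below \<open>N^3\<close> for this \<open>N\<close>.\<close>
  define N where "N = (3 * D + 1) ^ 2 + 1"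
  define I where "I = {..<N} \<times> {..<N} \<times> {..<N}"
  define mon where "mon = (\<lambda>(i, j, k). f0 ^ i * (f1 ^ j * f2 ^ k))"
  let ?E = "nat_box (3 * N * D)"
  have mon_keys: "Poly_Mapping.keys (mon x) \<subseteq> ?E" if x: "x \<in> I" for x
  proof -
    obtain i j k where ijk: "x = (i, j, k)" by (cases x)
    have "Poly_Mapping.keys (mon x) \<subseteq> nat_box (i * D + (j * D + k * D))"
      unfolding mon_def ijk prod.case by (intro keys_times_box keys_power_box D)
    also have "\<dots> \<subseteq> ?E"
    proof (rule nat_box_mono)
      have "i * D + (j * D + k * D) = (i + j + k) * D" by (simp add: algebra_simps)
      also have "\<dots> \<le> (3 * N) * D" using x unfolding I_def ijk by (intro mult_le_mono1) auto
      finally show "i * D + (j * D + k * D) \<le> 3 * N * D" .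
    qed
    finally show ?thesis .
  qed
  have "card ?E < card I"
  proof -
    have "1 \<le> N" by (simp add: N_def)
    then have le: "3 * N * D + 1 \<le> N * (3 * D + 1)" by (simp add: algebra_simps)
    have "card ?E \<le> (3 * N * D + 1) ^ 2" by (rule card_nat_box_le)
    also have "\<dots> \<le> (N * (3 * D + 1)) ^ 2" using le by (intro power_mono) auto
    also have "\<dots> = N ^ 2 * (3 * D + 1) ^ 2" by (rule power_mult_distrib)
    also have "\<dots> < N ^ 2 * N" by (intro mult_strict_left_mono) (auto simp: N_def)
    also have "\<dots> = card I" by (simp add: I_def power2_eq_square)
    finally show ?thesis .
  qed
  then obtain c where c: "\<exists>x\<in>I. c x \<noteq> 0"
    "\<And>e. e \<in> ?E \<Longrightarrow> (\<Sum>x\<in>I. Poly_Mapping.lookup (mon x) e * c x) = 0"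
    using underdetermined_system[of ?E I "\<lambda>e x. Poly_Mapping.lookup (mon x) e"] finite_nat_box
    by (auto simp: I_def)
  have "(\<Sum>x\<in>I. Poly_Mapping.single 0 (c x) * mon x) = 0"
  proof (rule poly_mapping_eqI)
    fix e
    have "Poly_Mapping.lookup (\<Sum>x\<in>I. Poly_Mapping.single 0 (c x) * mon x) e
        = (\<Sum>x\<in>I. Poly_Mapping.lookup (mon x) e * c x)"
      by (simp add: lookup_sum lookup_single_times) (simp add: mult.commute)
    also have "\<dots> = 0"
    proof (cases "e \<in> ?E")
      case False
      then have "Poly_Mapping.lookup (mon x) e = 0" if "x \<in> I" for x
        using mon_keys[OF that] by (auto simp: in_keys_iff)
      then show ?thesis by simp
    qed (rule c(2))
    finally show "Poly_Mapping.lookup (\<Sum>x\<in>I. Poly_Mapping.single 0 (c x) * mon x) e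
      = Poly_Mapping.lookup 0 e" by simp
  qed
  also have "(\<Sum>x\<in>I. Poly_Mapping.single 0 (c x) * mon x)
      = (\<Sum>i<N. \<Sum>j<N. \<Sum>k<N. Poly_Mapping.single 0 (c (i, j, k)) * mon (i, j, k))"
    unfolding I_def by (simp add: sum.cartesian_product)
  also have "\<dots> = (\<Sum>i<N. f0 ^ i * (\<Sum>j<N. f1 ^ j *
      (\<Sum>k<N. f2 ^ k * Poly_Mapping.single 0 (c (i, j, k)))))"
    by (simp add: mon_def sum_distrib_left mult_ac)
  finally have "(\<Sum>i<N. f0 ^ i * (\<Sum>j<N. f1 ^ j *
      (\<Sum>k<N. f2 ^ k * Poly_Mapping.single 0 (c (i, j, k))))) = 0" .
  moreover have "\<exists>i<N. \<exists>j<N. \<exists>k<N. c (i, j, k) \<noteq> 0" using c(1) by (auto simp: I_def)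
  ultimately show ?thesis
    by (intro exI[of _ N] exI[of _ "\<lambda>i j k. c (i, j, k)"]) blast
qed

text \<open>
  Dividing the relation by the power \<open>x^m\<close>, which is not in the prime \<open>Q\<close>, leaves an element of \<open>Q\<close>
  that is congruent to \<open>h m\<close> modulo \<open>x\<close>. This is the step in the Coquand-Lombardi description of Krull
  dimension by identities.
\<close>

lemma lowest_coefficient_in_prime:
  fixes x :: "(real \<times> real) \<Rightarrow>\<^sub>0 'k::field"
  assumes Q: "primeideal Q (semigroup_ring S)" and Q': "ideal Q' (semigroup_ring S)" "Q \<subseteq> Q'"
    and x: "x \<in> Q'" "x \<notin> Q" and h: "\<And>i. supported (h i)"
    and sum: "(\<Sum>i<N. x ^ i * h i) \<in> Q" and m: "m < N" "\<And>i. i < m \<Longrightarrow> h i = 0"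
  shows "h m \<in> Q'"
proof -
  have sx: "supported x" using idealD(1)[OF Q'(1) x(1)] .
  have pow: "x ^ i \<notin> Q" for i
  proof (induction i)
    case (Suc i)
    then show ?case using primeidealD(3)[OF Q, of x "x ^ i"] sx x(2) supported_power by auto
  qed (use primeidealD(2)[OF Q] in simp)
  let ?H = "\<Sum>i\<in>{Suc m..<N}. x ^ (i - Suc m) * h i"
  have sH: "supported ?H" using sx h by (intro supported_sum supported_times supported_power)
  have "(\<Sum>i<N. x ^ i * h i) = (\<Sum>i\<in>{m..<N}. x ^ i * h i)"
    using m(2) by (intro sum.mono_neutral_right) auto
  also have "\<dots> = x ^ m * h m + (\<Sum>i\<in>{Suc m..<N}. x ^ i * h i)"
    using m(1) by (rule sum.atLeast_Suc_lessThan)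
  also have "(\<Sum>i\<in>{Suc m..<N}. x ^ i * h i) = (\<Sum>i\<in>{Suc m..<N}. x ^ m * (x * (x ^ (i - Suc m) * h i)))"
  proof (rule sum.cong[OF refl])
    fix i assume "i \<in> {Suc m..<N}"
    then have "i = m + Suc (i - Suc m)" by simp
    then have "x ^ i = x ^ m * (x * x ^ (i - Suc m))" by (metis power_Suc power_add)
    then show "x ^ i * h i = x ^ m * (x * (x ^ (i - Suc m) * h i))" by (simp add: mult.assoc)
  qed
  also have "\<dots> = x ^ m * (x * ?H)" by (simp add: sum_distrib_left)
  finally have "x ^ m * (h m + x * ?H) \<in> Q" using sum by (simp add: distrib_left)
  then have "h m + x * ?H \<in> Q"
    using primeidealD(3)[OF Q] pow supported_power[OF sx] supported_add[OF h supported_times[OF sx sH]]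
    by blast
  then have "h m + x * ?H - x * ?H \<in> Q'"
    using Q' idealD(5,6)[OF Q'(1)] x(1) sH by blast
  then show ?thesis by simp
qed

text \<open>
  A relation between \<open>x \<in> Q1 - Q0\<close>, \<open>y \<in> Q2 - Q1\<close> and \<open>w\<close> lies in \<open>Q0\<close>. Its lowest coefficient
  in \<open>x\<close> is in \<open>Q1\<close>, and the lowest coefficient in \<open>y\<close> of the latter is in \<open>Q2\<close>. This replaces the
  Nullstellensatz.
\<close>

lemma polynomial_in_prime_of_height_two:
  fixes w :: "(real \<times> real) \<Rightarrow>\<^sub>0 'k::field"
  assumes prime: "primeideal Q0 (semigroup_ring S)" "primeideal Q1 (semigroup_ring S)"
      "primeideal Q2 (semigroup_ring S)"
    and chain: "Q0 \<subset> Q1" "Q1 \<subset> Q2" and w: "supported w"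
  shows "\<exists>N c. (\<exists>k<N. c k \<noteq> 0) \<and> (\<Sum>k<N. w ^ k * Poly_Mapping.single 0 (c k)) \<in> Q2"
proof -
  note ideal = prime[THEN primeidealD(1)]
  obtain x y where x: "x \<in> Q1" "x \<notin> Q0" and y: "y \<in> Q2" "y \<notin> Q1" using chain by blast
  note sx = idealD(1)[OF ideal(2) x(1)] and sy = idealD(1)[OF ideal(3) y(1)]
  obtain N c where nz: "\<exists>i<N. \<exists>j<N. \<exists>k<N. c i j k \<noteq> 0" and
    eq: "(\<Sum>i<N. x ^ i * (\<Sum>j<N. y ^ j * (\<Sum>k<N. w ^ k * Poly_Mapping.single 0 (c i j k)))) = 0"
    using algebraic_dependence[OF sx sy w] by blast
  let ?g = "\<lambda>i j. \<Sum>k<N. w ^ k * Poly_Mapping.single 0 (c i j k)"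
  let ?h = "\<lambda>i. \<Sum>j<N. y ^ j * ?g i j"
  have sg: "supported (?g i j)" for i j
    using w by (intro supported_sum supported_times supported_power) auto
  have sh: "supported (?h i)" for i
    by (rule supported_sum) (rule supported_times[OF supported_power[OF sy] sg])
  define i where "i = (LEAST i. i < N \<and> (\<exists>j<N. \<exists>k<N. c i j k \<noteq> 0))"
  have i: "i < N" "\<exists>j<N. \<exists>k<N. c i j k \<noteq> 0" using LeastI_ex[OF nz] unfolding i_def by blast+
  have i0: "c i' j k = 0" if "i' < i" "j < N" "k < N" for i' j k
    using not_less_Least[of i'] that i(1) unfolding i_def by force
  have "?h i \<in> Q1"
  proof (rule lowest_coefficient_in_prime[OF prime(1) ideal(2) _ x sh _ i(1)])
    show "(\<Sum>i<N. x ^ i * ?h i) \<in> Q0" using eq idealD(2)[OF ideal(1)] by simp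
    show "?h i' = 0" if "i' < i" for i' using i0[OF that] by simp
  qed (use chain in blast)
  define j where "j = (LEAST j. j < N \<and> (\<exists>k<N. c i j k \<noteq> 0))"
  have j: "j < N" "\<exists>k<N. c i j k \<noteq> 0" using LeastI_ex[OF i(2)] unfolding j_def by blast+
  have j0: "c i j' k = 0" if "j' < j" "k < N" for j' k
    using not_less_Least[of j'] that j(1) unfolding j_def by force
  have "?g i j \<in> Q2"
  proof (rule lowest_coefficient_in_prime[OF prime(2) ideal(3) _ y sg _ j(1)])
    show "?h i \<in> Q1" by fact
    show "?g i j' = 0" if "j' < j" for j' using j0[OF that] by simp
  qed (use chain in blast)
  then show ?thesis using j(2) by blast
qed

text \<open>
  One more step of the same kind would put a nonzero constant into \<open>Q3\<close>.
\<close>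

lemma no_prime_chain_of_length_three:
  fixes Q0 Q1 Q2 Q3 :: "((real \<times> real) \<Rightarrow>\<^sub>0 'k::field) set"
  assumes prime: "primeideal Q0 (semigroup_ring S)" "primeideal Q1 (semigroup_ring S)"
      "primeideal Q2 (semigroup_ring S)" "primeideal Q3 (semigroup_ring S)"
    and chain: "Q0 \<subset> Q1" "Q1 \<subset> Q2" "Q2 \<subset> Q3"
  shows False
proof -
  note ideal = prime[THEN primeidealD(1)]
  obtain w where w: "w \<in> Q3" "w \<notin> Q2" using chain by blast
  obtain N c where nz: "\<exists>k<N. c k \<noteq> 0" and
    sum: "(\<Sum>k<N. w ^ k * Poly_Mapping.single 0 (c k)) \<in> Q2"
    using polynomial_in_prime_of_height_two[OF prime(1-3) chain(1,2) idealD(1)[OF ideal(4) w(1)]]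
    by blast
  define k where "k = (LEAST k. k < N \<and> c k \<noteq> 0)"
  have k: "k < N" "c k \<noteq> 0" using LeastI_ex[OF nz] unfolding k_def by blast+
  have k0: "c k' = 0" if "k' < k" for k'
    using not_less_Least[of k'] that k(1) unfolding k_def by force
  have "Poly_Mapping.single 0 (c k) \<in> Q3"
    by (rule lowest_coefficient_in_prime[OF prime(3) ideal(4) _ w _ sum k(1)])
      (use chain(3) k0 in auto)
  then show False using const_notin_primeideal[OF prime(4) k(2)] by blast
qed

lemma ray_poly_in_prime_of_height_two:
  fixes Q0 Q1 Q2 :: "((real \<times> real) \<Rightarrow>\<^sub>0 'k::field) set"
  assumes prime: "primeideal Q0 (semigroup_ring S)" "primeideal Q1 (semigroup_ring S)"
      "primeideal Q2 (semigroup_ring S)"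
    and chain: "Q0 \<subset> Q1" "Q1 \<subset> Q2" and u: "u \<in> S"
  shows "\<exists>d c. c d \<noteq> 0 \<and> ray_poly u d c \<in> Q2"
proof -
  have pow: "Poly_Mapping.single u (1::'k) ^ k = Poly_Mapping.single (real k *\<^sub>R u) 1" for k
    by (induction k) (simp_all add: mult_single scaleR_left_distrib)
  obtain N c where nz: "\<exists>k<N. c k \<noteq> 0" and
    sum: "(\<Sum>k<N. Poly_Mapping.single u (1::'k) ^ k * Poly_Mapping.single 0 (c k)) \<in> Q2"
    using polynomial_in_prime_of_height_two[OF prime chain supported_single[OF u]] by blast
  let ?K = "{k. k < N \<and> c k \<noteq> 0}"
  define d where "d = Max ?K"
  have "d \<in> ?K" unfolding d_def using nz by (intro Max_in) auto
  then have d: "d < N" "c d \<noteq> 0" by auto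
  have d0: "c k = 0" if "d < k" "k < N" for k
  proof (rule ccontr)
    assume "c k \<noteq> 0"
    then have "k \<le> d" unfolding d_def using that by (intro Max_ge) auto
    then show False using that by simp
  qed
  have "(\<Sum>k<N. Poly_Mapping.single u (1::'k) ^ k * Poly_Mapping.single 0 (c k))
      = (\<Sum>k<N. Poly_Mapping.single (real k *\<^sub>R u) (c k))"
    by (simp add: pow mult_single)
  also have "\<dots> = ray_poly u d c" unfolding ray_poly_def
    using d(1) d0 by (intro sum.mono_neutral_right) auto
  finally show ?thesis using sum d(2) by metis
qed

end

section \<open>The Hilbert basis theorem for finitely generated monoids\<close>

definition nat_combinations :: "(real \<times> real) set \<Rightarrow> (real \<times> real) set" where
  "nat_combinations A = {\<Sum>a\<in>A. real (m a) *\<^sub>R a |m :: real \<times> real \<Rightarrow> nat. True}"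

lemma nat_combinations_add:
  assumes "x \<in> nat_combinations A" "y \<in> nat_combinations A"
  shows "x + y \<in> nat_combinations A"
proof -
  obtain m n :: "real \<times> real \<Rightarrow> nat" where "x = (\<Sum>a\<in>A. real (m a) *\<^sub>R a)" "y = (\<Sum>a\<in>A. real (n a) *\<^sub>R a)"
    using assms unfolding nat_combinations_def by blast
  then have "x + y = (\<Sum>a\<in>A. real (m a + n a) *\<^sub>R a)"
    by (simp add: sum.distrib scaleR_left_distrib)
  then show ?thesis unfolding nat_combinations_def by (intro CollectI exI[of _ "\<lambda>a. m a + n a"]) simp
qed

lemma nat_combinations_0: "0 \<in> nat_combinations A"
  unfolding nat_combinations_def by (intro CollectI exI[of _ "\<lambda>_. 0"]) simp

lemma nat_combinations_scale:
  assumes "finite A" "a \<in> A"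
  shows "real k *\<^sub>R a \<in> nat_combinations A"
proof -
  have "(\<Sum>b\<in>A. real (if b = a then k else 0) *\<^sub>R b) = (\<Sum>b\<in>A. if b = a then real k *\<^sub>R a else 0)"
    by (intro sum.cong) auto
  also have "\<dots> = real k *\<^sub>R a" using assms by simp
  finally show ?thesis unfolding nat_combinations_def
    by (intro CollectI exI[of _ "\<lambda>b. if b = a then k else 0"]) simp
qed

lemma generated_semigroup_eq:
  assumes "finite A" shows "generated_semigroup A = nat_combinations A"
proof
  have "(\<Sum>i<p. real (k i) *\<^sub>R f i) \<in> nat_combinations A" if "\<forall>i<p. f i \<in> A" for p :: nat and k f
    using that
  proof (induction p)
    case (Suc p)
    then show ?case using nat_combinations_add nat_combinations_scale[OF assms] by simp
  qed (simp add: nat_combinations_0)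
  then show "generated_semigroup A \<subseteq> nat_combinations A"
    unfolding generated_semigroup_def by blast
  show "nat_combinations A \<subseteq> generated_semigroup A"
  proof
    fix x assume "x \<in> nat_combinations A"
    then obtain m :: "real \<times> real \<Rightarrow> nat" where m: "x = (\<Sum>a\<in>A. real (m a) *\<^sub>R a)"
      unfolding nat_combinations_def by blast
    obtain f where f: "bij_betw f {..<card A} A"
      using ex_bij_betw_nat_finite[OF assms] by (auto simp: atLeast0LessThan)
    have "x = (\<Sum>i<card A. real (m (f i)) *\<^sub>R f i)"
      unfolding m by (rule sum.reindex_bij_betw[OF f, symmetric])
    moreover have "\<forall>i<card A. f i \<in> A" using f by (auto simp: bij_betw_def)
    ultimately show "x \<in> generated_semigroup A"
      unfolding generated_semigroup_def
      by (intro CollectI exI[of _ "card A"] exI[of _ "\<lambda>i. m (f i)"] exI[of _ f]) blast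
  qed
qed

lemma nat_combinations_insert:
  assumes "finite A" "a \<notin> A"
  shows "nat_combinations (insert a A) = {t + real k *\<^sub>R a |t k. t \<in> nat_combinations A}"
proof
  show "nat_combinations (insert a A) \<subseteq> {t + real k *\<^sub>R a |t k. t \<in> nat_combinations A}"
  proof
    fix x assume "x \<in> nat_combinations (insert a A)"
    then obtain m :: "real \<times> real \<Rightarrow> nat" where m: "x = (\<Sum>a\<in>insert a A. real (m a) *\<^sub>R a)"
      unfolding nat_combinations_def by blast
    then have "x = (\<Sum>a\<in>A. real (m a) *\<^sub>R a) + real (m a) *\<^sub>R a"
      using assms by (simp add: add.commute)
    then show "x \<in> {t + real k *\<^sub>R a |t k. t \<in> nat_combinations A}"
      unfolding nat_combinations_def by blast
  qed
  have "t \<in> nat_combinations (insert a A)" if t: "t \<in> nat_combinations A" for t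
  proof -
    obtain m :: "real \<times> real \<Rightarrow> nat" where m: "t = (\<Sum>a\<in>A. real (m a) *\<^sub>R a)"
      using t unfolding nat_combinations_def by blast
    have "t = (\<Sum>b\<in>insert a A. real ((m(a := 0)) b) *\<^sub>R b)"
      unfolding m using assms by (simp add: sum.insert) (intro sum.cong, auto)
    then show ?thesis unfolding nat_combinations_def by blast
  qed
  then show "{t + real k *\<^sub>R a |t k. t \<in> nat_combinations A} \<subseteq> nat_combinations (insert a A)"
    using nat_combinations_add nat_combinations_scale[of "insert a A" a] assms(1) by blast
qed

text \<open>
  Induction on the generators. The elements \<open>t + k a\<close> of \<open>E\<close> are sorted into layers by \<open>k\<close>. Finitely
  many \<open>t\<close> suffice for the union of all layers; they are available from some level \<open>K\<close> on, and the
  finitely many layers below \<open>K\<close> are treated separately.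
\<close>

lemma dickson:
  assumes "finite A" "E \<subseteq> nat_combinations A"
  shows "\<exists>F\<subseteq>E. finite F \<and> (\<forall>e\<in>E. \<exists>f\<in>F. e - f \<in> nat_combinations A)"
  using assms
proof (induction A arbitrary: E rule: finite_induct)
  case empty
  then have "E \<subseteq> {0}" by (simp add: nat_combinations_def)
  then show ?case by (intro exI[of _ E]) (auto simp: nat_combinations_def dest: finite_subset)
next
  case (insert a A)
  note ins = nat_combinations_insert[OF insert.hyps(1,2)]
  define layer where "layer k = {t \<in> nat_combinations A. t + real k *\<^sub>R a \<in> E}" for k
  have "\<exists>F\<subseteq>(\<Union>k. layer k). finite F \<and> (\<forall>t\<in>(\<Union>k. layer k). \<exists>f\<in>F. t - f \<in> nat_combinations A)"
    by (rule insert.IH) (auto simp: layer_def)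
  then obtain F0 where F0: "F0 \<subseteq> (\<Union>k. layer k)" "finite F0"
    "\<forall>t\<in>(\<Union>k. layer k). \<exists>f\<in>F0. t - f \<in> nat_combinations A" by (elim exE conjE)
  have "\<forall>f\<in>F0. \<exists>k. f \<in> layer k" using F0(1) by blast
  then obtain \<kappa> where \<kappa>: "\<And>f. f \<in> F0 \<Longrightarrow> f \<in> layer (\<kappa> f)" by metis
  obtain K where K: "\<And>f. f \<in> F0 \<Longrightarrow> \<kappa> f \<le> K"
    using finite_nat_set_iff_bounded_le[of "\<kappa> ` F0"] F0(2) by auto
  have "\<forall>k. \<exists>F\<subseteq>layer k. finite F \<and> (\<forall>t\<in>layer k. \<exists>f\<in>F. t - f \<in> nat_combinations A)"
    by (intro allI insert.IH) (auto simp: layer_def)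
  then obtain G where G: "\<And>k. G k \<subseteq> layer k" "\<And>k. finite (G k)"
    "\<And>k t. t \<in> layer k \<Longrightarrow> \<exists>f\<in>G k. t - f \<in> nat_combinations A" by metis
  let ?F = "(\<lambda>f. f + real (\<kappa> f) *\<^sub>R a) ` F0 \<union> (\<Union>k<K. (\<lambda>f. f + real k *\<^sub>R a) ` G k)"
  have "finite ?F" using F0(2) G(2) by blast
  moreover have "?F \<subseteq> E"
  proof -
    have "t + real k *\<^sub>R a \<in> E" if "t \<in> layer k" for t k using that by (simp add: layer_def)
    then show ?thesis using \<kappa> G(1) by blast
  qed
  moreover have "\<forall>e\<in>E. \<exists>f\<in>?F. e - f \<in> nat_combinations (insert a A)"
  proof
    fix e assume e: "e \<in> E"
    obtain t k where tk: "e = t + real k *\<^sub>R a" "t \<in> nat_combinations A"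
      using e insert.prems ins by blast
    then have layer: "t \<in> layer k" using e by (simp add: layer_def)
    show "\<exists>f\<in>?F. e - f \<in> nat_combinations (insert a A)"
    proof (cases "k < K")
      case True
      obtain f where f: "f \<in> G k" "t - f \<in> nat_combinations A" using G(3)[OF layer] by blast
      have "e - (f + real k *\<^sub>R a) = (t - f) + real 0 *\<^sub>R a" by (simp add: tk)
      then have "e - (f + real k *\<^sub>R a) \<in> nat_combinations (insert a A)" using f(2) ins by blast
      then show ?thesis using f(1) True by blast
    next
      case False
      obtain f where f: "f \<in> F0" "t - f \<in> nat_combinations A" using F0(3) layer by blast
      have "\<kappa> f \<le> k" using K[OF f(1)] False by simp
      then have "e - (f + real (\<kappa> f) *\<^sub>R a) = (t - f) + real (k - \<kappa> f) *\<^sub>R a"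
        by (simp add: tk of_nat_diff scaleR_left_diff_distrib)
      then have "e - (f + real (\<kappa> f) *\<^sub>R a) \<in> nat_combinations (insert a A)" using f(2) ins by blast
      then show ?thesis using f(1) by blast
    qed
  qed
  ultimately show ?case by (intro exI[of _ ?F] conjI)
qed

lemma wf_lex_less: "wf {(p, q). p \<in> \<nat> \<times> \<nat> \<and> q \<in> \<nat> \<times> \<nat> \<and> lex_less p q}"
proof (rule wf_subset)
  let ?n = "\<lambda>p :: real \<times> real. (nat \<lfloor>fst p\<rfloor>, nat \<lfloor>snd p\<rfloor>)"
  show "wf (inv_image (less_than <*lex*> less_than) ?n)" by (intro wf_inv_image wf_lex_prod wf_less_than)
  show "{(p, q). p \<in> \<nat> \<times> \<nat> \<and> q \<in> \<nat> \<times> \<nat> \<and> lex_less p q} \<subseteq> inv_image (less_than <*lex*> less_than) ?n"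
    by (auto simp: lex_less_def elim!: Nats_cases)
qed

context plane_monoid begin

text \<open>
  Finitely many elements of the ideal are enough to have a leading exponent below every leading exponent
  of the ideal, in the sense of divisibility in \<open>S\<close>. Subtracting a multiple of one of them makes the
  leading exponent of a given element smaller, and the lexicographic order is well-founded.
\<close>

lemma noetherian_semigroup_ring:
  fixes K :: "'k::field itself"
  assumes A: "finite A" "S = generated_semigroup A"
  shows "noetherian_ring (semigroup_ring S :: ((real \<times> real) \<Rightarrow>\<^sub>0 'k) ring)" (is "noetherian_ring ?R")
proof (rule R.noetherian_ringI)
  fix I :: "((real \<times> real) \<Rightarrow>\<^sub>0 'k) set"
  assume I: "ideal I (semigroup_ring S)"
  have S: "S = nat_combinations A" using A generated_semigroup_eq by simp
  define top where "top e f \<longleftrightarrow> e \<in> Poly_Mapping.keys f \<and> (\<forall>a\<in>Poly_Mapping.keys f. a \<noteq> e \<longrightarrow> lex_less a e)"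
    for e and f :: "(real \<times> real) \<Rightarrow>\<^sub>0 'k"
  have topS: "e \<in> S" if "f \<in> I" "top e f" for e f
    using that idealD(1)[OF I that(1)] by (auto simp: top_def supported_def)
  have ex_top: "\<exists>e. top e f" if "f \<noteq> 0" for f
  proof -
    have "Poly_Mapping.keys f \<noteq> {}" using that by (auto simp: poly_mapping_eq_iff fun_eq_iff in_keys_iff)
    then show ?thesis using ex_lex_greatest[OF finite_keys] unfolding top_def by blast
  qed
  define E where "E = {e. \<exists>f\<in>I. top e f}"
  have "E \<subseteq> nat_combinations A" using topS S by (auto simp: E_def)
  then obtain F where F: "F \<subseteq> E" "finite F" "\<And>e. e \<in> E \<Longrightarrow> \<exists>f\<in>F. e - f \<in> S"
    using dickson[OF A(1), of E] S by metis
  have "\<forall>e\<in>F. \<exists>f. f \<in> I \<and> top e f" using F(1) by (auto simp: E_def)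
  then obtain \<phi> where \<phi>: "\<And>e. e \<in> F \<Longrightarrow> \<phi> e \<in> I" "\<And>e. e \<in> F \<Longrightarrow> top e (\<phi> e)" by metis
  let ?J = "genideal ?R (\<phi> ` F)"
  have sub: "\<phi> ` F \<subseteq> carrier ?R" using \<phi>(1) idealD(1)[OF I] by auto
  have J: "ideal ?J ?R" using R.genideal_ideal[OF sub] .
  have "f \<in> ?J" if "f \<in> I" "top e f" for e f
    using that
  proof (induction e arbitrary: f rule: wf_induct_rule[OF wf_lex_less])
    case (1 e)
    then have e: "e \<in> E" "e \<in> S" using topS by (auto simp: E_def)
    then obtain e' where e': "e' \<in> F" "e - e' \<in> S" using F(3) by blast
    let ?g = "\<phi> e'"
    \<comment> \<open>The factor that makes the leading terms of \<open>f\<close> and of the multiple of \<open>\<phi> e'\<close> agree.\<close>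
    let ?c = "Poly_Mapping.lookup f e / Poly_Mapping.lookup ?g e'"
    let ?m = "Poly_Mapping.single (e - e') ?c"
    have g: "?g \<in> ?J" "?g \<in> I" "top e' ?g" using e'(1) \<phi> R.genideal_self[OF sub] by auto
    have m: "supported ?m" using e'(2) by (rule supported_single)
    let ?f = "f - ?m * ?g"
    have fI: "?f \<in> I" by (rule idealD(6)[OF I 1(2) idealD(4)[OF I g(2) m]])
    have keys: "lex_less a e" if a: "a \<in> Poly_Mapping.keys ?f" for a
    proof -
      have "a \<noteq> e"
        using a g(3) by (auto simp: in_keys_iff lookup_minus lookup_single_times top_def)
      moreover have "a \<in> Poly_Mapping.keys f \<or> a \<in> Poly_Mapping.keys (?m * ?g)"
        using a by (auto simp: in_keys_iff lookup_minus)
      moreover have "lex_less a e" if "a \<in> Poly_Mapping.keys (?m * ?g)" "a \<noteq> e"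
      proof -
        have "a - (e - e') \<in> Poly_Mapping.keys ?g"
          using that(1) by (auto simp: in_keys_iff lookup_single_times)
        moreover have "a - (e - e') \<noteq> e'" using that(2) by (simp add: algebra_simps)
        ultimately have "lex_less (a - (e - e')) e'" using g(3) by (simp add: top_def)
        then show ?thesis by (auto simp: lex_less_def)
      qed
      ultimately show ?thesis using 1(3) by (auto simp: top_def)
    qed
    have "?f \<in> ?J"
    proof (cases "?f = 0")
      case False
      then obtain a where a: "top a ?f" using ex_top by blast
      then have "lex_less a e" using keys by (simp add: top_def)
      then show ?thesis using 1(1)[of a ?f] topS[OF fI a] e(2) nat fI a by auto
    qed (use idealD(2)[OF J] in simp)
    then have "?f + ?m * ?g \<in> ?J" by (rule idealD(3)[OF J _ idealD(4)[OF J g(1) m]])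
    then show ?case by simp
  qed
  then have "f \<in> ?J" if "f \<in> I" for f
    using that ex_top[of f] idealD(2)[OF J] by (cases "f = 0") auto
  then have "I \<subseteq> ?J" by (rule subsetI)
  moreover have "?J \<subseteq> I" using \<phi>(1) by (intro R.genideal_minimal I) auto
  ultimately have "I = ?J" by blast
  then show "\<exists>A\<subseteq>carrier ?R. finite A \<and> I = genideal ?R A" using sub F(2) by blast
qed

section \<open>Saturated monoids have Cohen-Macaulay semigroup rings\<close>

lemma regular_singleton:
  fixes f :: "(real \<times> real) \<Rightarrow>\<^sub>0 'k::field"
  assumes "f \<in> P" "f \<noteq> 0" and P: "primeideal P (semigroup_ring S)"
  shows "regular_sequence (semigroup_ring S) [f]"
proof -
  have sf: "supported f" by (rule idealD(1)[OF primeidealD(1)[OF P] assms(1)])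
  have "genideal (semigroup_ring S) {f} \<subseteq> P"
    using assms(1) by (intro R.genideal_minimal primeidealD(1)[OF P]) auto
  then have "genideal (semigroup_ring S) {f} \<noteq> carrier (semigroup_ring S)"
    using primeidealD(2)[OF P] R.one_closed by auto
  then show ?thesis using sf assms(2)
    by (simp add: regular_sequence_def genideal_empty plane_times_eq_0_iff)
qed

text \<open>
  For chains of length 0, 1 and 2 that end in \<open>P\<close>, the regular sequences are the empty one, a nonzero
  element of \<open>P\<close>, and two polynomials in \<open>x^u\<close> and \<open>x^v\<close>.
\<close>

theorem saturated_imp_cohen_macaulay:
  fixes K :: "'k::field itself"
  assumes A: "finite A" "S = generated_semigroup A"
    and sat: "\<And>z. z + u \<in> S \<Longrightarrow> z + v \<in> S \<Longrightarrow> z \<in> S"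
    and u: "u \<in> S" "u \<noteq> 0" and v: "v \<in> S" "v \<noteq> 0"
  shows "cohen_macaulay_semigroup K S"
  unfolding cohen_macaulay_semigroup_def cohen_macaulay_ring_def
proof (intro conjI allI impI)
  let ?R = "semigroup_ring S :: ((real \<times> real) \<Rightarrow>\<^sub>0 'k) ring"
  show "cring ?R" by (rule R.is_cring)
  show "noetherian_ring ?R" using noetherian_semigroup_ring[OF A] .
  fix P assume "maximalideal P ?R"
  then have P: "primeideal P ?R" by (rule R.maximalideal_prime)
  have depthI: "enat (length xs) \<le> ideal_depth ?R P"
    if "regular_sequence ?R xs" "set xs \<subseteq> P" for xs
    unfolding ideal_depth_def using that by (intro Sup_upper) blast
  have "prime_height ?R P \<le> ideal_depth ?R P"
    unfolding prime_height_def
  proof (rule Sup_least)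
    fix x assume "x \<in> {enat n |n. \<exists>Q :: nat \<Rightarrow> ((real \<times> real) \<Rightarrow>\<^sub>0 'k) set.
      (\<forall>i\<le>n. primeideal (Q i) ?R) \<and> (\<forall>i<n. Q i \<subset> Q (Suc i)) \<and> Q n = P}"
    then obtain n and Q :: "nat \<Rightarrow> ((real \<times> real) \<Rightarrow>\<^sub>0 'k) set" where n: "x = enat n"
      and prime: "\<And>i. i \<le> n \<Longrightarrow> primeideal (Q i) ?R"
      and chain: "\<And>i. i < n \<Longrightarrow> Q i \<subset> Q (Suc i)" and Qn: "Q n = P" by blast
    consider "n = 0" | "n = 1" | "n = 2" | "3 \<le> n" by linarith
    then show "x \<le> ideal_depth ?R P"
    proof cases
      case 1
      then show ?thesis by (simp add: n enat_0)
    next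
      case 2
      then obtain f where f: "f \<in> P" "f \<notin> Q 0" using chain[of 0] Qn by auto
      then have "f \<noteq> 0" using idealD(2)[OF primeidealD(1)[OF prime[of 0]]] by auto
      then show ?thesis using depthI[of "[f]"] regular_singleton[OF f(1) _ P] f(1) 2 n by simp
    next
      case 3
      have primes: "primeideal (Q 0) ?R" "primeideal (Q 1) ?R" using prime[of 0] prime[of 1] 3 by auto
      have chains: "Q 0 \<subset> Q 1" "Q 1 \<subset> P" using chain[of 0] chain[of 1] Qn 3
        by (auto simp: numeral_2_eq_2)
      obtain d c where p: "c d \<noteq> 0" "ray_poly u d c \<in> P"
        using ray_poly_in_prime_of_height_two[OF primes P chains u(1)] by blast
      obtain m b where q: "b m \<noteq> 0" "ray_poly v m b \<in> P"
        using ray_poly_in_prime_of_height_two[OF primes P chains v(1)] by blast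
      let ?p = "ray_poly u d c" and ?q = "ray_poly v m b"
      have "genideal ?R {?p, ?q} \<subseteq> P"
        using p(2) q(2) by (intro R.genideal_minimal primeidealD(1)[OF P]) auto
      then have proper: "genideal ?R {?p, ?q} \<noteq> carrier ?R"
        using primeidealD(2)[OF P] R.one_closed by auto
      have p0: "?p \<noteq> 0" using lookup_ray_poly_top[OF u(2), of d c] p(1) by auto
      have "regular_sequence ?R [?p, ?q]"
        unfolding regular_pair_iff
      proof (intro conjI allI impI)
        fix y assume "supported y" "\<exists>h. ?q * y = ?p * h \<and> supported h"
        then obtain w where w: "supported y" "supported w" "?q * y = ?p * w" by blast
        have "\<exists>h. supported h \<and> y = ?p * h"
          by (rule saturated_imp_regular[where v = v and b = b and m = m and w = w])
            (fact sat u v p(1) q(1) w)+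
        then show "\<exists>h. y = ?p * h \<and> supported h" by blast
      next
        show "supported ?p" "supported ?q" using u v supported_ray_poly by blast+
        show "genideal ?R {?p, ?q} \<noteq> carrier ?R" by (rule proper)
        show "y = 0" if "?p * y = 0" for y using that p0 by (simp add: plane_times_eq_0_iff)
      qed
      then show ?thesis using depthI[of "[?p, ?q]"] p(2) q(2) 3 n by (simp add: numeral_2_eq_2)
    next
      case 4
      then show ?thesis
        using no_prime_chain_of_length_three[of "Q 0" "Q 1" "Q 2" "Q 3"] prime chain[of 0] chain[of 1] chain[of 2]
        by (simp add: numeral_2_eq_2 numeral_3_eq_3)
    qed
  qed
  then show "ideal_depth ?R P = prime_height ?R P"
    using R.ideal_depth_le_prime_height[OF P] by (rule antisym[rotated])
qed

end

section \<open>Lattice points, discs and their cone\<close>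

text \<open>
  The determinant of the two vectors, with the sign that makes it positive if \<open>p\<close> is steeper than \<open>q\<close>.
\<close>

definition cross :: "real \<times> real \<Rightarrow> real \<times> real \<Rightarrow> real" where
  "cross p q = snd p * fst q - snd q * fst p"

lemma cross_simps:
  "cross (p + p') q = cross p q + cross p' q" "cross q (p + p') = cross q p + cross q p'"
  "cross (p - p') q = cross p q - cross p' q" "cross q (p - p') = cross q p - cross q p'"
  "cross (a *\<^sub>R p) q = a * cross p q" "cross q (a *\<^sub>R p) = a * cross q p"
  "cross p p = 0"
  by (simp_all add: cross_def algebra_simps)

lemma cramer:
  assumes "cross p q \<noteq> 0"
  shows "z = (cross z q / cross p q) *\<^sub>R p + (cross p z / cross p q) *\<^sub>R q"
proof -
  have "cross z q * fst p + cross p z * fst q = fst z * cross p q"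
    "cross z q * snd p + cross p z * snd q = snd z * cross p q"
    by (simp_all add: cross_def algebra_simps)
  then have "fst z = (cross z q * fst p + cross p z * fst q) / cross p q"
    "snd z = (cross z q * snd p + cross p z * snd q) / cross p q"
    using assms by (simp_all add: field_simps)
  then show ?thesis by (simp add: prod_eq_iff add_divide_distrib)
qed

lemma cross_int:
  assumes "p \<in> \<nat> \<times> \<nat>" "q \<in> \<nat> \<times> \<nat>" shows "cross p q \<in> \<int>"
proof -
  have "fst p \<in> \<int>" "snd p \<in> \<int>" "fst q \<in> \<int>" "snd q \<in> \<int>"
    using assms Nats_subset_Ints unfolding mem_Times_iff by blast+
  then show ?thesis unfolding cross_def by simp
qed

lemma nat_pair_diff:
  fixes p q :: "real \<times> real"
  assumes "p \<in> \<nat> \<times> \<nat>" "q \<in> \<nat> \<times> \<nat>" "fst q \<le> fst p" "snd q \<le> snd p"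
  shows "p - q \<in> \<nat> \<times> \<nat>"
proof -
  have "fst p - fst q \<in> \<nat>" "snd p - snd q \<in> \<nat>"
    using assms by (simp_all add: mem_Times_iff)
  then show ?thesis by (simp add: mem_Times_iff)
qed

lemma nat_pair_scale:
  fixes p :: "real \<times> real" shows "p \<in> \<nat> \<times> \<nat> \<Longrightarrow> real k *\<^sub>R p \<in> \<nat> \<times> \<nat>"
  unfolding mem_Times_iff fst_scaleR snd_scaleR real_scaleR_def by (intro conjI Nats_mult) simp_all

lemma nat_pair_add:
  fixes p q :: "real \<times> real"
  shows "p \<in> \<nat> \<times> \<nat> \<Longrightarrow> q \<in> \<nat> \<times> \<nat> \<Longrightarrow> p + q \<in> \<nat> \<times> \<nat>"
  by (simp add: mem_Times_iff)

lemma circle_semigroup_iff: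
  "x \<in> circle_semigroup c r \<longleftrightarrow> x \<in> \<nat> \<times> \<nat> \<and> (\<exists>i::nat. norm (x - real i *\<^sub>R c) \<le> real i * r)"
  by (auto simp: circle_semigroup_def dist_norm norm_minus_commute)

lemma plane_monoid_circle_semigroup: "plane_monoid (circle_semigroup c r)"
proof
  show "circle_semigroup c r \<subseteq> \<nat> \<times> \<nat>" by (auto simp: circle_semigroup_def)
  show "0 \<in> circle_semigroup c r"
    by (auto simp: circle_semigroup_iff zero_prod_def intro!: exI[of _ 0])
  fix x y assume "x \<in> circle_semigroup c r" "y \<in> circle_semigroup c r"
  then obtain i j :: nat where ij: "x \<in> \<nat> \<times> \<nat>" "norm (x - real i *\<^sub>R c) \<le> real i * r"
    "y \<in> \<nat> \<times> \<nat>" "norm (y - real j *\<^sub>R c) \<le> real j * r" by (auto simp: circle_semigroup_iff)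
  have "x + y - real (i + j) *\<^sub>R c = (x - real i *\<^sub>R c) + (y - real j *\<^sub>R c)"
    by (simp add: scaleR_left_distrib)
  then have "norm (x + y - real (i + j) *\<^sub>R c) \<le> norm (x - real i *\<^sub>R c) + norm (y - real j *\<^sub>R c)"
    by (metis norm_triangle_ineq)
  also have "\<dots> \<le> real (i + j) * r" using ij by (simp add: distrib_right)
  finally show "x + y \<in> circle_semigroup c r"
    using ij nat_pair_add unfolding circle_semigroup_iff by blast
qed

lemma circle_semigroup_multiple:
  assumes "s \<in> circle_semigroup c r" "s \<noteq> 0"
  shows "\<exists>i m. 0 < i \<and> norm (m - c) \<le> r \<and> s = real i *\<^sub>R m"
proof -
  obtain i :: nat where i: "norm (s - real i *\<^sub>R c) \<le> real i * r"
    using assms(1) by (auto simp: circle_semigroup_iff)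
  have i0: "0 < i" using i assms(2) by (cases i) auto
  define m where "m = s /\<^sub>R real i"
  have s: "s = real i *\<^sub>R m" using i0 by (simp add: m_def)
  have "real i * norm (m - c) = norm (s - real i *\<^sub>R c)"
    unfolding s by (simp add: scaleR_diff_right[symmetric])
  then have "real i * norm (m - c) \<le> real i * r" using i by simp
  then have "norm (m - c) \<le> r" using i0 by simp
  then show ?thesis using i0 s by blast
qed

text \<open>
  The part of the disc in the quadrant is convex, so a combination with several summands can be
  replaced by a multiple of one point.
\<close>

lemma circle_cone_iff:
  "x \<in> circle_cone c r \<longleftrightarrow> x \<in> \<nat> \<times> \<nat> \<and>
    (x = 0 \<or> (\<exists>q w. q \<in> \<rat> \<and> 0 < q \<and> norm (w - c) \<le> r \<and> 0 \<le> fst w \<and> 0 \<le> snd w \<and> x = q *\<^sub>R w))"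
  (is "_ \<longleftrightarrow> ?N x \<and> (x = 0 \<or> ?Q x)")
proof -
  let ?D = "cball c r \<inter> ({0..} \<times> {0..})"
  have D: "w \<in> ?D \<longleftrightarrow> norm (w - c) \<le> r \<and> 0 \<le> fst w \<and> 0 \<le> snd w" for w
    by (cases w) (auto simp: dist_norm norm_minus_commute)
  have cone_imp: "x = 0 \<or> ?Q x" if "x \<in> rational_cone ?D"
  proof -
    obtain p :: nat and q f where pqf: "x = (\<Sum>i<p. q i *\<^sub>R f i)"
      "\<And>i. i < p \<Longrightarrow> q i \<in> \<rat>" "\<And>i. i < p \<Longrightarrow> 0 \<le> q i" "\<And>i. i < p \<Longrightarrow> f i \<in> ?D"
      using \<open>x \<in> rational_cone ?D\<close> unfolding rational_cone_def by blast
    let ?s = "\<Sum>i<p. q i"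
    have s0: "0 \<le> ?s" using pqf(3) by (intro sum_nonneg) auto
    show ?thesis
    proof (cases "?s = 0")
      case True
      then have "q i = 0" if "i < p" for i
        using sum_nonneg_eq_0_iff[of "{..<p}" q] pqf(3) that by auto
      then show ?thesis using pqf(1) by simp
    next
      case False
      have "convex ?D" by (intro convex_Int convex_cball convex_Times convex_real_interval)
      then have w: "(\<Sum>i<p. (q i / ?s) *\<^sub>R f i) \<in> ?D"
        using pqf False s0 by (intro convex_sum) (auto simp: sum_divide_distrib[symmetric])
      have "x = ?s *\<^sub>R (\<Sum>i<p. (q i / ?s) *\<^sub>R f i)"
        using False by (simp add: pqf(1) scaleR_sum_right)
      moreover have "?s \<in> \<rat>" using pqf(2) by (intro Rats_sum) auto
      moreover have "0 < ?s" using s0 False by simp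
      ultimately show ?thesis using w[unfolded D] by blast
    qed
  qed
  have imp_cone: "x \<in> rational_cone ?D" if "?Q x"
  proof -
    obtain q w where "q \<in> \<rat>" "0 < q" "w \<in> ?D" "x = q *\<^sub>R w" using \<open>?Q x\<close> D by blast
    then show ?thesis unfolding rational_cone_def
      by (intro CollectI exI[of _ 1] exI[of _ "\<lambda>_. q"] exI[of _ "\<lambda>_. w"]) auto
  qed
  have "0 \<in> rational_cone ?D"
    unfolding rational_cone_def by (intro CollectI exI[of _ 0]) simp
  then have "x \<in> rational_cone ?D" if "x = 0 \<or> ?Q x"
    using that imp_cone by (elim disjE) simp_all
  then have "x \<in> rational_cone ?D \<longleftrightarrow> x = 0 \<or> ?Q x" using cone_imp by (rule iffI[rotated])
  then show ?thesis unfolding circle_cone_def Int_iff by (simp only: conj_commute)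
qed

lemma nat_pair_nonneg:
  fixes p :: "real \<times> real"
  assumes "p \<in> \<nat> \<times> \<nat>" shows "0 \<le> fst p \<and> 0 \<le> snd p"
proof -
  obtain i j where "fst p = of_nat i" "snd p = of_nat j"
    using assms unfolding mem_Times_iff by (metis Nats_cases)
  then show ?thesis by simp
qed

lemma circle_semigroup_subset_cone: "circle_semigroup c r \<subseteq> circle_cone c r"
proof
  fix s assume s: "s \<in> circle_semigroup c r"
  then have nat: "s \<in> \<nat> \<times> \<nat>" by (simp add: circle_semigroup_iff)
  show "s \<in> circle_cone c r"
  proof (cases "s = 0")
    case False
    then obtain i m where im: "0 < i" "norm (m - c) \<le> r" "s = real i *\<^sub>R m"
      using circle_semigroup_multiple s by blast
    then have "0 \<le> fst m" "0 \<le> snd m"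
      using nat_pair_nonneg[OF nat] by (auto simp: zero_le_mult_iff)
    then show ?thesis using im nat unfolding circle_cone_iff by (metis Rats_of_nat of_nat_0_less_iff)
  qed (use nat in \<open>simp add: circle_cone_iff\<close>)
qed

text \<open>
  With \<open>N = k i\<close>, the point \<open>x + k n\<close> is \<open>x + N m\<close>. If \<open>m\<close> is an inner point of the disc, then \<open>N m\<close> is
  far inside the disc of radius \<open>N r\<close> around \<open>N c\<close>. If \<open>m\<close> is on the boundary, then for a fixed integer
  \<open>s\<close> one compares with the disc of index \<open>N + s\<close>. For \<open>\<nu> = m - c\<close> the terms of order \<open>N^2\<close> cancel and
  those of order \<open>N\<close> leave the condition \<open>\<nu> \<bullet> x < s (\<nu> \<bullet> m)\<close>. Some \<open>s\<close> of suitable sign satisfies it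
  if \<open>\<nu> \<bullet> m \<noteq> 0\<close>, and \<open>s = 0\<close> does if the tangent at \<open>m\<close> passes through the origin and \<open>x\<close> lies strictly on
  the side of the disc.
\<close>

lemma translate_into_circle_semigroup:
  assumes n: "n \<in> \<nat> \<times> \<nat>" "n = real i *\<^sub>R m" "0 < i" "norm (m - c) \<le> r" and x: "x \<in> \<nat> \<times> \<nat>"
    and cond: "norm (m - c) < r \<or> (m - c) \<bullet> m \<noteq> 0 \<or> (m - c) \<bullet> x < 0"
  shows "\<exists>k::nat. x + real k *\<^sub>R n \<in> circle_semigroup c r"
proof -
  have mem: "x + real k *\<^sub>R n \<in> circle_semigroup c r"
    if "norm (x + real k *\<^sub>R n - real l *\<^sub>R c) \<le> real l * r" for k l
    using that nat_pair_add[OF x nat_pair_scale[OF n(1)]] unfolding circle_semigroup_iff by blast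
  show ?thesis
  proof (cases "norm (m - c) < r")
    case True
    obtain k :: nat where "norm x / (r - norm (m - c)) < real k" using reals_Archimedean2 by blast
    then have "norm x \<le> real k * (r - norm (m - c))" using True by (simp add: field_simps)
    also have "\<dots> \<le> real (k * i) * (r - norm (m - c))"
    proof (intro mult_right_mono of_nat_mono)
      show "k \<le> k * i" using n(3) by simp
    qed (use True in simp)
    finally have k: "norm x \<le> real (k * i) * (r - norm (m - c))" .
    have "norm (x + real k *\<^sub>R n - real (k * i) *\<^sub>R c) = norm (x + real (k * i) *\<^sub>R (m - c))"
      by (simp add: n(2) algebra_simps)
    also have "\<dots> \<le> norm x + real (k * i) * norm (m - c)"
      by (rule order_trans[OF norm_triangle_ineq]) simp
    also have "\<dots> \<le> real (k * i) * r" using k by (simp add: algebra_simps)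
    finally show ?thesis using mem by blast
  next
    case False
    define \<nu> where "\<nu> = m - c"
    have "norm \<nu> = r" using False n(4) by (simp add: \<nu>_def)
    then have \<nu>: "\<nu> \<bullet> \<nu> = r ^ 2" by (simp add: power2_norm_eq_inner[symmetric])
    have r0: "0 \<le> r" using n(4) norm_ge_zero[of "m - c"] by linarith
    have "\<exists>s::int. \<nu> \<bullet> x < s * (\<nu> \<bullet> m)"
    proof (cases "\<nu> \<bullet> m = 0")
      case True
      then show ?thesis using cond False by (simp add: \<nu>_def)
    next
      case nz: False
      obtain t :: nat where t: "\<bar>\<nu> \<bullet> x\<bar> / \<bar>\<nu> \<bullet> m\<bar> < real t" using reals_Archimedean2 by blast
      then have "\<bar>\<nu> \<bullet> x\<bar> < real t * \<bar>\<nu> \<bullet> m\<bar>" using nz by (simp add: field_simps)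
      then have "\<nu> \<bullet> x < real t * \<bar>\<nu> \<bullet> m\<bar>" by simp
      moreover have "real t * \<bar>\<nu> \<bullet> m\<bar> = real_of_int (if \<nu> \<bullet> m < 0 then - int t else int t) * (\<nu> \<bullet> m)"
        by simp
      ultimately show ?thesis by metis
    qed
    then obtain s :: int where s: "\<nu> \<bullet> x < s * (\<nu> \<bullet> m)" by blast
    \<comment> \<open>Relative to the centre of the disc of index \<open>N + s\<close> the point \<open>x + k n\<close> is \<open>N \<nu> + A\<close>, and up to
      bounded terms its squared norm is smaller than the squared radius by \<open>2 N \<epsilon>\<close>.\<close>
    define A where "A = x - s *\<^sub>R c"
    define \<epsilon> where "\<epsilon> = s * r ^ 2 - \<nu> \<bullet> A"
    have "\<epsilon> = s * (\<nu> \<bullet> m) - \<nu> \<bullet> x"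
    proof -
      have "m = c + \<nu>" by (simp add: \<nu>_def)
      then have "\<nu> \<bullet> m = \<nu> \<bullet> c + r ^ 2" by (simp add: inner_add_right \<nu>)
      then show ?thesis by (simp add: \<epsilon>_def A_def inner_diff_right algebra_simps)
    qed
    then have \<epsilon>: "0 < \<epsilon>" using s by simp
    obtain k :: nat where k: "max (A \<bullet> A / (2 * \<epsilon>)) \<bar>s\<bar> < real k" using reals_Archimedean2 by blast
    define N where "N = real (k * i)"
    have "k \<le> k * i" using n(3) by simp
    then have "real k \<le> N" unfolding N_def by (rule of_nat_mono)
    then have kN: "A \<bullet> A / (2 * \<epsilon>) < N" "\<bar>s\<bar> < N" using k by auto
    then have N: "A \<bullet> A \<le> 2 * N * \<epsilon>" using \<epsilon> by (simp add: field_simps)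
    define l where "l = nat (int (k * i) + s)"
    have l: "real l = N + s" using kN(2) unfolding l_def N_def by linarith
    have l0: "0 \<le> N + s" using l by (metis of_nat_0_le_iff)
    have "x + real k *\<^sub>R n - real l *\<^sub>R c = N *\<^sub>R \<nu> + A"
      unfolding l A_def \<nu>_def by (simp add: n(2) N_def algebra_simps)
    moreover have "(N *\<^sub>R \<nu> + A) \<bullet> (N *\<^sub>R \<nu> + A) = N\<^sup>2 * r\<^sup>2 + 2 * N * (\<nu> \<bullet> A) + A \<bullet> A"
      by (simp add: inner_add_left inner_add_right \<nu> power2_eq_square inner_commute algebra_simps)
    moreover have "\<dots> \<le> ((N + s) * r)\<^sup>2"
    proof -
      have "((N + s) * r)\<^sup>2 = N\<^sup>2 * r\<^sup>2 + 2 * N * (s * r\<^sup>2) + (s * r)\<^sup>2"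
        by (simp add: power2_eq_square algebra_simps)
      moreover have "0 \<le> (s * r)\<^sup>2" by simp
      moreover have "2 * N * (\<nu> \<bullet> A) + 2 * N * \<epsilon> = 2 * N * (s * r\<^sup>2)"
        by (simp add: \<epsilon>_def algebra_simps)
      ultimately show ?thesis using N by linarith
    qed
    ultimately have "norm (x + real k *\<^sub>R n - real l *\<^sub>R c) \<le> real l * r"
      using l l0 r0 by (simp add: norm_le_square)
    then show ?thesis using mem by blast
  qed
qed

text \<open>
  The hyperplane tangent to the ball at \<open>m\<close> passes through the origin, so it is the zero set of the
  linear form \<open>(m - c) \<bullet> w\<close>; the ball lies on one side of it and touches it at \<open>m\<close> only.
\<close>

lemma supporting_line:
  fixes m c w :: "'a::real_inner"
  assumes m: "norm (m - c) = r" "(m - c) \<bullet> m = 0" and w: "norm (w - c) \<le> r"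
  shows "(m - c) \<bullet> w \<le> 0" "(m - c) \<bullet> w = 0 \<Longrightarrow> w = m"
proof -
  define \<nu> where "\<nu> = m - c"
  have \<nu>: "\<nu> \<bullet> \<nu> = r ^ 2" using m(1) by (simp add: \<nu>_def power2_norm_eq_inner[symmetric])
  have c: "\<nu> \<bullet> c = - (r ^ 2)"
  proof -
    have "c = m - \<nu>" by (simp add: \<nu>_def)
    then have "\<nu> \<bullet> c = \<nu> \<bullet> m - \<nu> \<bullet> \<nu>" by (simp add: inner_diff_right)
    then show ?thesis using m(2) \<nu> by (simp add: \<nu>_def)
  qed
  have w2: "(w - c) \<bullet> (w - c) \<le> r ^ 2"
    using power_mono[OF w norm_ge_zero, of 2] by (simp add: power2_norm_eq_inner)
  have eq: "(w - m) \<bullet> (w - m) = (w - c) \<bullet> (w - c) - 2 * (\<nu> \<bullet> w) - r ^ 2"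
  proof -
    have diff: "w - m = (w - c) - \<nu>" by (simp add: \<nu>_def)
    have "(u - \<nu>) \<bullet> (u - \<nu>) = u \<bullet> u - 2 * (\<nu> \<bullet> u) + \<nu> \<bullet> \<nu>" for u
      by (simp add: inner_diff_left inner_diff_right inner_commute)
    then have "(w - m) \<bullet> (w - m) = (w - c) \<bullet> (w - c) - 2 * (\<nu> \<bullet> (w - c)) + \<nu> \<bullet> \<nu>"
      unfolding diff .
    then show ?thesis using \<nu> c by (simp add: inner_diff_right)
  qed
  have "0 \<le> (w - m) \<bullet> (w - m)" by simp
  then show "(m - c) \<bullet> w \<le> 0" using eq w2 unfolding \<nu>_def by linarith
  assume "(m - c) \<bullet> w = 0"
  then have "(w - m) \<bullet> (w - m) = 0"
    using eq w2 \<open>0 \<le> (w - m) \<bullet> (w - m)\<close> unfolding \<nu>_def by linarith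
  then show "w = m" by simp
qed

text \<open>
  If the tangent at \<open>m\<close> passes through the origin, then \<open>w\<close> lies strictly on the side of the disc, as it
  is not on the ray of \<open>m\<close>.
\<close>

lemma translate_cone_point_into_semigroup:
  assumes n: "n \<in> circle_semigroup c r" "n \<noteq> 0"
    and x: "x \<in> \<nat> \<times> \<nat>" "x = q *\<^sub>R w" "0 < q" "norm (w - c) \<le> r"
    and off: "cross n x \<noteq> 0"
  shows "\<exists>k::nat. x + real k *\<^sub>R n \<in> circle_semigroup c r"
proof -
  obtain i m where im: "0 < i" "norm (m - c) \<le> r" "n = real i *\<^sub>R m"
    using circle_semigroup_multiple[OF n] by blast
  have "(m - c) \<bullet> x < 0" if t: "norm (m - c) = r" "(m - c) \<bullet> m = 0"
  proof -
    have "w \<noteq> m" using off by (auto simp: x(2) im(3) cross_simps)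
    then have "(m - c) \<bullet> w < 0" using supporting_line[OF t x(4)] by force
    then show ?thesis using x(3) by (simp add: x(2) mult_pos_neg)
  qed
  then show ?thesis
    using translate_into_circle_semigroup[OF _ im(3,1,2) x(1)] n(1) im(2) circle_semigroup_iff[of n]
    by fastforce
qed

text \<open>
  If the ray is tangent to the disc, all points of \<open>S\<close> on it are multiples \<open>l m\<close> of the point of tangency
  with natural \<open>l\<close>, and the fractional part is again such a multiple; it belongs to \<open>S\<close>. Otherwise the
  fractional part at least enters \<open>S\<close> after adding a multiple of \<open>n\<close>, and lies in the cone over the disc.
\<close>

lemma fractional_part_on_ray:
  assumes n: "n \<in> circle_semigroup c r" "n \<noteq> 0" and s: "s \<in> circle_semigroup c r" "s = t *\<^sub>R n" "0 \<le> t"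
  shows "(t - \<lfloor>t\<rfloor>) *\<^sub>R n \<in> circle_semigroup c r \<or>
    (t - \<lfloor>t\<rfloor>) *\<^sub>R n \<in> \<nat> \<times> \<nat> \<and> (\<exists>q w. norm (w - c) \<le> r \<and> 0 \<le> q \<and> (t - \<lfloor>t\<rfloor>) *\<^sub>R n = q *\<^sub>R w) \<and>
    (\<exists>k::nat. (t - \<lfloor>t\<rfloor>) *\<^sub>R n + real k *\<^sub>R n \<in> circle_semigroup c r)"
proof (cases "s = 0")
  case True
  then have "t = 0" using n s(2) by simp
  then show ?thesis using plane_monoid.zero_in[OF plane_monoid_circle_semigroup] by simp
next
  case False
  let ?x = "(t - \<lfloor>t\<rfloor>) *\<^sub>R n"
  have nat: "n \<in> \<nat> \<times> \<nat>" "s \<in> \<nat> \<times> \<nat>" using n s by (simp_all add: circle_semigroup_iff)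
  have k: "real (nat \<lfloor>t\<rfloor>) = \<lfloor>t\<rfloor>" using s(3) by simp
  then have x: "?x = s - real (nat \<lfloor>t\<rfloor>) *\<^sub>R n" by (simp add: s(2) scaleR_left_diff_distrib)
  have xnn: "0 \<le> fst ?x \<and> 0 \<le> snd ?x" using nat_pair_nonneg[OF nat(1)] by simp
  have xnat: "?x \<in> \<nat> \<times> \<nat>"
    unfolding x using xnn[unfolded x] by (intro nat_pair_diff nat nat_pair_scale) auto
  obtain i m where im: "0 < i" "norm (m - c) \<le> r" "n = real i *\<^sub>R m"
    using circle_semigroup_multiple[OF n] by blast
  show ?thesis
  proof (cases "norm (m - c) = r \<and> (m - c) \<bullet> m = 0")
    case False
    then have "\<exists>k::nat. ?x + real k *\<^sub>R n \<in> circle_semigroup c r"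
      using im(2) by (intro translate_into_circle_semigroup[OF nat(1) im(3,1,2) xnat]) auto
    moreover have "?x = ((t - \<lfloor>t\<rfloor>) * real i) *\<^sub>R m" by (simp add: im(3))
    moreover have "0 \<le> (t - \<lfloor>t\<rfloor>) * real i" by simp
    ultimately show ?thesis using xnat im(2) by blast
  next
    case True
    obtain j w where jw: "0 < j" "norm (w - c) \<le> r" "s = real j *\<^sub>R w"
      using circle_semigroup_multiple[OF s(1) False] by blast
    have "real j * ((m - c) \<bullet> w) = t * real i * ((m - c) \<bullet> m)"
      using jw(3) s(2) im(3) by (metis inner_scaleR_right scaleR_scaleR mult.commute)
    then have "(m - c) \<bullet> w = 0" using True jw(1) by simp
    then have "w = m" using supporting_line(2)[of m c r w] True jw(2) by blast
    define l where "l = real j - \<lfloor>t\<rfloor> * real i"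
    have xl: "?x = l *\<^sub>R m"
      unfolding x k using jw(3) \<open>w = m\<close> im(3) by (simp add: l_def scaleR_left_diff_distrib)
    have "m \<noteq> 0" using im n(2) by auto
    have "real j = t * real i"
    proof -
      have "real j *\<^sub>R m = s" using jw(3) \<open>w = m\<close> by simp
      also have "s = (t * real i) *\<^sub>R m" using s(2) im(3) by simp
      finally show ?thesis using \<open>m \<noteq> 0\<close> by (metis scaleR_cancel_right)
    qed
    then have "l = (t - \<lfloor>t\<rfloor>) * real i" by (simp add: l_def algebra_simps)
    then have l0: "0 \<le> l" by simp
    define z where "z = int j - \<lfloor>t\<rfloor> * int i"
    define l' where "l' = nat z"
    have "real_of_int z = l" by (simp add: z_def l_def)
    moreover from this have "0 \<le> z" using l0 by linarith
    ultimately have l': "real l' = l" by (simp add: l'_def)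
    have "norm (?x - real l' *\<^sub>R c) = real l' * norm (m - c)"
      unfolding xl l' using l0 by (simp add: scaleR_diff_right[symmetric])
    then have "norm (?x - real l' *\<^sub>R c) \<le> real l' * r" using True by simp
    then show ?thesis using xnat unfolding circle_semigroup_iff by blast
  qed
qed

section \<open>The two extremal rays\<close>

lemma extremal_ray_direction:
  assumes "extremal_ray C \<tau>" "n \<in> \<tau>" "n \<noteq> 0"
  shows "\<tau> = {t *\<^sub>R n |t. 0 \<le> t}" "\<tau> face_of (convex_cone hull C)"
proof -
  obtain d where d: "\<tau> = {t *\<^sub>R d |t. 0 \<le> t}" "\<tau> face_of (convex_cone hull C)"
    using assms(1) by (auto simp: extremal_ray_def)
  obtain t where t: "n = t *\<^sub>R d" "0 \<le> t" using assms(2) d(1) by blast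
  then have "0 < t" using assms(3) by (cases "t = 0") auto
  have "x \<in> {t *\<^sub>R n |t. 0 \<le> t}" if "x \<in> {t *\<^sub>R d |t. 0 \<le> t}" for x
  proof -
    obtain s where "x = s *\<^sub>R d" "0 \<le> s" using \<open>x \<in> {t *\<^sub>R d |t. 0 \<le> t}\<close> by blast
    then have "x = (s / t) *\<^sub>R n" "0 \<le> s / t" using t(1) \<open>0 < t\<close> by simp_all
    then show ?thesis by blast
  qed
  moreover have "x \<in> {t *\<^sub>R d |t. 0 \<le> t}" if "x \<in> {t *\<^sub>R n |t. 0 \<le> t}" for x
    using that t by force
  ultimately show "\<tau> = {t *\<^sub>R n |t. 0 \<le> t}" unfolding d(1) by blast
  show "\<tau> face_of (convex_cone hull C)" by fact
qed

text \<open>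
  If \<open>\<alpha>\<close> were negative, the point \<open>\<beta> n'\<close> of the ray would be the sum of the points \<open>x\<close> and
  \<open>- \<alpha> n\<close> of the cone, and the face property would put \<open>n\<close> on the ray of \<open>n'\<close>.
\<close>

lemma extremal_ray_bounds_cone:
  assumes C: "C \<subseteq> \<nat> \<times> \<nat>" and \<tau>: "extremal_ray C \<tau>" "n' \<in> \<tau>" "n' \<noteq> 0" "n' \<in> C"
    and n: "n \<in> C" "cross n n' \<noteq> 0" and x: "x \<in> C" "x = \<alpha> *\<^sub>R n + \<beta> *\<^sub>R n'"
  shows "0 \<le> \<alpha>"
proof (rule ccontr)
  assume "\<not> 0 \<le> \<alpha>"
  then have \<alpha>: "0 < - \<alpha>" by simp
  note ray = extremal_ray_direction[OF \<tau>(1-3)]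
  let ?y = "(- \<alpha>) *\<^sub>R n"
  let ?K = "convex_cone hull C"
  have K: "x \<in> ?K" "?y \<in> ?K"
    by (rule hull_inc[OF x(1)]) (rule convex_cone_hull_mul[OF hull_inc[OF n(1)] less_imp_le[OF \<alpha>]])
  have sum: "x + ?y = \<beta> *\<^sub>R n'" by (simp add: x(2))
  have nn: "0 \<le> fst z \<and> 0 \<le> snd z" if "z \<in> C" for z
    using nat_pair_nonneg C that by blast
  have "0 \<le> \<beta>"
  proof -
    have "0 \<le> \<beta> * fst n'" "0 \<le> \<beta> * snd n'"
    proof -
      have "0 \<le> fst x + (- \<alpha>) * fst n" "0 \<le> snd x + (- \<alpha>) * snd n"
        using nn[OF x(1)] mult_nonneg_nonneg[OF less_imp_le[OF \<alpha>], of "fst n"]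
          mult_nonneg_nonneg[OF less_imp_le[OF \<alpha>], of "snd n"] nn[OF n(1)]
        by (simp_all add: add_nonneg_nonneg del: mult_minus_left)
      moreover have "fst x + (- \<alpha>) * fst n = \<beta> * fst n'" "snd x + (- \<alpha>) * snd n = \<beta> * snd n'"
        using arg_cong[OF sum, of fst] arg_cong[OF sum, of snd] by simp_all
      ultimately show "0 \<le> \<beta> * fst n'" "0 \<le> \<beta> * snd n'" by simp_all
    qed
    moreover have "0 < fst n' \<or> 0 < snd n'"
      using nn[OF \<tau>(4)] \<tau>(3) by (auto simp: prod_eq_iff)
    ultimately show ?thesis by (auto simp: zero_le_mult_iff)
  qed
  have mid: "midpoint x ?y = (\<beta> / 2) *\<^sub>R n'"
    unfolding midpoint_def sum by simp
  then have mid\<tau>: "midpoint x ?y \<in> \<tau>" using \<open>0 \<le> \<beta>\<close> unfolding ray(1) by fastforce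
  have "?y \<in> \<tau>"
  proof (cases "x = ?y")
    case True
    then show ?thesis using mid\<tau> by (metis midpoint_idem)
  next
    case False
    then show ?thesis using face_ofD[OF ray(2) _ K mid\<tau>] by (simp del: scaleR_minus_left)
  qed
  then obtain t where "?y = t *\<^sub>R n'" unfolding ray(1) by blast
  then have "cross ?y n' = 0" by (simp only: cross_simps mult_zero_right)
  then show False using \<alpha> n(2) by (simp only: cross_simps) simp
qed

text \<open>
  The fractional part of an element of the ray is an element of \<open>S\<close> shorter than \<open>n\<close>, hence 0.
\<close>

lemma ray_generated_by_least:
  assumes S: "S = circle_semigroup c r" and \<tau>: "\<tau> = {t *\<^sub>R n |t. 0 \<le> t}" and n: "least_on_ray S \<tau> n"
    and n': "n' \<in> S" "n' \<noteq> 0" "cross n' n \<noteq> 0"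
    and sat: "\<And>x i j. x + real i *\<^sub>R n \<in> S \<Longrightarrow> x + real j *\<^sub>R n' \<in> S \<Longrightarrow> x \<in> S"
  shows "S \<inter> \<tau> = range (\<lambda>k::nat. real k *\<^sub>R n)"
proof -
  interpret plane_monoid S unfolding S by (rule plane_monoid_circle_semigroup)
  have nS: "n \<in> S" "n \<noteq> 0" and least: "\<And>y. y \<in> S \<Longrightarrow> y \<in> \<tau> \<Longrightarrow> y \<noteq> 0 \<Longrightarrow> norm n \<le> norm y"
    using n unfolding least_on_ray_def is_arg_min_def by (auto simp: not_less)
  have "real k *\<^sub>R n \<in> S \<inter> \<tau>" for k using scale_in[OF nS(1)] unfolding \<tau> by auto
  moreover have "s \<in> range (\<lambda>k::nat. real k *\<^sub>R n)" if s\<tau>: "s \<in> S" "s \<in> \<tau>" for s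
  proof -
    obtain t where t: "s = t *\<^sub>R n" "0 \<le> t" using s\<tau>(2) unfolding \<tau> by blast
    define f where "f = t - \<lfloor>t\<rfloor>"
    have f: "0 \<le> f" "f < 1" unfolding f_def by linarith+
    let ?x = "f *\<^sub>R n"
    have xS: "?x \<in> S"
    proof (cases "?x \<in> S")
      case False
      have "?x \<in> circle_semigroup c r \<or> ?x \<in> \<nat> \<times> \<nat> \<and>
          (\<exists>q w. norm (w - c) \<le> r \<and> 0 \<le> q \<and> ?x = q *\<^sub>R w) \<and>
          (\<exists>k::nat. ?x + real k *\<^sub>R n \<in> circle_semigroup c r)"
        unfolding f_def using fractional_part_on_ray[of n c r s t] nS s\<tau>(1) t unfolding S by blast
      then have "?x \<in> \<nat> \<times> \<nat>" "\<exists>q w. norm (w - c) \<le> r \<and> 0 \<le> q \<and> ?x = q *\<^sub>R w"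
        "\<exists>k::nat. ?x + real k *\<^sub>R n \<in> S"
        using False unfolding S[symmetric] by (elim disjE conjE; simp)+
      then obtain q w k where qwk: "?x \<in> \<nat> \<times> \<nat>" "norm (w - c) \<le> r" "0 \<le> q" "?x = q *\<^sub>R w"
        "?x + real k *\<^sub>R n \<in> S"
        by (elim exE conjE)
      have x0: "?x \<noteq> 0" using False zero_in by metis
      then have "0 < q" using qwk(3,4) by (cases "q = 0") auto
      moreover have "cross n' ?x \<noteq> 0" using x0 n'(3) by (simp add: cross_simps)
      ultimately have "\<exists>j::nat. ?x + real j *\<^sub>R n' \<in> S"
        unfolding S using n'(1,2) qwk(1,2,4) by (intro translate_cone_point_into_semigroup[of n' c r ?x q w]) (auto simp: S)
      then show ?thesis using sat qwk(5) by blast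
    qed
    have "f = 0"
    proof (rule ccontr)
      assume "f \<noteq> 0"
      then have "norm n \<le> norm ?x"
        using nS(2) f(1) xS unfolding \<tau> by (intro least) (auto simp: \<tau>)
      also have "\<dots> = f * norm n" using f(1) by simp
      finally show False using f(2) nS(2) by simp
    qed
    then have "t = real (nat \<lfloor>t\<rfloor>)" using t(2) by (simp add: f_def)
    then show ?thesis using t(1) by (metis rangeI)
  qed
  ultimately show ?thesis by blast
qed

locale circle_rays =
  fixes c :: "real \<times> real" and r :: real and S C \<tau>\<^sub>1 \<tau>\<^sub>2 :: "(real \<times> real) set" and n\<^sub>1 n\<^sub>2 :: "real \<times> real"
  assumes S: "S = circle_semigroup c r" and C: "C = circle_cone c r"
    and extremal: "extremal_ray C \<tau>\<^sub>1" "extremal_ray C \<tau>\<^sub>2" and steep: "steeper \<tau>\<^sub>1 \<tau>\<^sub>2"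
    and least: "least_on_ray S \<tau>\<^sub>1 n\<^sub>1" "least_on_ray S \<tau>\<^sub>2 n\<^sub>2"
begin

sublocale plane_monoid S unfolding S by (rule plane_monoid_circle_semigroup)

lemma least_elements: "n\<^sub>1 \<in> S" "n\<^sub>1 \<noteq> 0" "n\<^sub>1 \<in> \<tau>\<^sub>1" "n\<^sub>2 \<in> S" "n\<^sub>2 \<noteq> 0" "n\<^sub>2 \<in> \<tau>\<^sub>2"
  using least unfolding least_on_ray_def is_arg_min_def by auto

lemma semigroup_subset_cone: "S \<subseteq> C" unfolding S C by (rule circle_semigroup_subset_cone)

lemma C_nat: "C \<subseteq> \<nat> \<times> \<nat>" unfolding C by (auto simp: circle_cone_def)

lemma rays: "\<tau>\<^sub>1 = {t *\<^sub>R n\<^sub>1 |t. 0 \<le> t}" "\<tau>\<^sub>2 = {t *\<^sub>R n\<^sub>2 |t. 0 \<le> t}"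
  using extremal_ray_direction extremal least_elements by blast+

lemma cross_pos: "0 < cross n\<^sub>1 n\<^sub>2"
  using steep least_elements unfolding steeper_def cross_def by (auto simp: case_prod_beta)

lemma cone_in_sector:
  assumes "x \<in> C" shows "0 \<le> cross x n\<^sub>2" "0 \<le> cross n\<^sub>1 x"
proof -
  note x = cramer[of n\<^sub>1 n\<^sub>2 x]
  have nC: "n\<^sub>1 \<in> C" "n\<^sub>2 \<in> C" using least_elements semigroup_subset_cone by blast+
  have "0 \<le> cross x n\<^sub>2 / cross n\<^sub>1 n\<^sub>2"
    by (rule extremal_ray_bounds_cone[OF C_nat extremal(2) least_elements(6,5) nC(2,1) _ assms x]) (use cross_pos in auto)
  then show "0 \<le> cross x n\<^sub>2" using cross_pos by (simp add: zero_le_divide_iff)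
  have "cross n\<^sub>2 n\<^sub>1 \<noteq> 0" using cross_pos by (simp add: cross_def)
  moreover have "x = (cross n\<^sub>1 x / cross n\<^sub>1 n\<^sub>2) *\<^sub>R n\<^sub>2 + (cross x n\<^sub>2 / cross n\<^sub>1 n\<^sub>2) *\<^sub>R n\<^sub>1"
    using x cross_pos by (simp add: add.commute)
  ultimately have "0 \<le> cross n\<^sub>1 x / cross n\<^sub>1 n\<^sub>2"
    by (intro extremal_ray_bounds_cone[OF C_nat extremal(1) least_elements(3,2) nC _ assms])
  then show "0 \<le> cross n\<^sub>1 x" using cross_pos by (simp add: zero_le_divide_iff)
qed

lemma on_ray_iff:
  assumes "x \<in> C" shows "x \<in> \<tau>\<^sub>1 \<longleftrightarrow> cross n\<^sub>1 x = 0" "x \<in> \<tau>\<^sub>2 \<longleftrightarrow> cross x n\<^sub>2 = 0"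
proof -
  have x: "x = (cross x n\<^sub>2 / cross n\<^sub>1 n\<^sub>2) *\<^sub>R n\<^sub>1 + (cross n\<^sub>1 x / cross n\<^sub>1 n\<^sub>2) *\<^sub>R n\<^sub>2"
    using cramer[of n\<^sub>1 n\<^sub>2 x] cross_pos by simp
  have nn: "0 \<le> cross x n\<^sub>2 / cross n\<^sub>1 n\<^sub>2" "0 \<le> cross n\<^sub>1 x / cross n\<^sub>1 n\<^sub>2"
    using cone_in_sector[OF assms] cross_pos by simp_all
  show "x \<in> \<tau>\<^sub>1 \<longleftrightarrow> cross n\<^sub>1 x = 0"
  proof
    assume "x \<in> \<tau>\<^sub>1" then show "cross n\<^sub>1 x = 0" unfolding rays by (auto simp: cross_simps)
  next
    assume "cross n\<^sub>1 x = 0"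
    then have "x = (cross x n\<^sub>2 / cross n\<^sub>1 n\<^sub>2) *\<^sub>R n\<^sub>1" using x by simp
    then show "x \<in> \<tau>\<^sub>1" unfolding rays using nn(1) by blast
  qed
  show "x \<in> \<tau>\<^sub>2 \<longleftrightarrow> cross x n\<^sub>2 = 0"
  proof
    assume "x \<in> \<tau>\<^sub>2" then show "cross x n\<^sub>2 = 0" unfolding rays by (auto simp: cross_simps)
  next
    assume "cross x n\<^sub>2 = 0"
    then have "x = (cross n\<^sub>1 x / cross n\<^sub>1 n\<^sub>2) *\<^sub>R n\<^sub>2" using x by simp
    then show "x \<in> \<tau>\<^sub>2" unfolding rays using nn(2) by blast
  qed
qed

lemma saturated_imp_interior_and_rays:
  assumes sat: "\<And>z. z + n\<^sub>1 \<in> S \<Longrightarrow> z + n\<^sub>2 \<in> S \<Longrightarrow> z \<in> S"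
  shows "S - (\<tau>\<^sub>1 \<union> \<tau>\<^sub>2) = C - (\<tau>\<^sub>1 \<union> \<tau>\<^sub>2)"
    "S \<inter> \<tau>\<^sub>1 = range (\<lambda>k::nat. real k *\<^sub>R n\<^sub>1)" "S \<inter> \<tau>\<^sub>2 = range (\<lambda>k::nat. real k *\<^sub>R n\<^sub>2)"
proof -
  have iter: "x \<in> S" if "x + real i *\<^sub>R n\<^sub>1 \<in> S" "x + real j *\<^sub>R n\<^sub>2 \<in> S" for x i j
    using saturated_iterate[OF sat least_elements(1,4) that] .
  have "x \<in> S" if x: "x \<in> C" "x \<notin> \<tau>\<^sub>1" "x \<notin> \<tau>\<^sub>2" for x
  proof -
    have "x \<noteq> 0" using x(2) unfolding rays by force
    then obtain q w where qw: "0 < q" "norm (w - c) \<le> r" "x = q *\<^sub>R w" "x \<in> \<nat> \<times> \<nat>"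
      using x(1) unfolding C circle_cone_iff by blast
    have off: "cross n\<^sub>1 x \<noteq> 0" "cross n\<^sub>2 x \<noteq> 0"
      using on_ray_iff[OF x(1)] x(2,3) by (simp_all add: cross_def)
    have "\<exists>k::nat. x + real k *\<^sub>R n\<^sub>1 \<in> S" "\<exists>k::nat. x + real k *\<^sub>R n\<^sub>2 \<in> S"
      using translate_cone_point_into_semigroup[OF _ least_elements(2) qw(4,3,1,2) off(1)]
        translate_cone_point_into_semigroup[OF _ least_elements(5) qw(4,3,1,2) off(2)] least_elements(1,4)
      unfolding S by blast+
    then show ?thesis using iter by blast
  qed
  then show "S - (\<tau>\<^sub>1 \<union> \<tau>\<^sub>2) = C - (\<tau>\<^sub>1 \<union> \<tau>\<^sub>2)" using semigroup_subset_cone by blast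
  have cr: "cross n\<^sub>2 n\<^sub>1 \<noteq> 0" "cross n\<^sub>1 n\<^sub>2 \<noteq> 0" using cross_pos by (simp_all add: cross_def)
  show "S \<inter> \<tau>\<^sub>1 = range (\<lambda>k::nat. real k *\<^sub>R n\<^sub>1)"
    by (rule ray_generated_by_least[OF S rays(1) least(1) least_elements(4,5) cr(1) iter])
  show "S \<inter> \<tau>\<^sub>2 = range (\<lambda>k::nat. real k *\<^sub>R n\<^sub>2)"
    by (rule ray_generated_by_least[OF S rays(2) least(2) least_elements(1,2) cr(2)]) (rule iter)
qed

text \<open>
  The coordinates of \<open>z\<close> in the basis \<open>n\<^sub>1, n\<^sub>2\<close> are nonnegative rationals, since \<open>z + n\<^sub>1\<close> and
  \<open>z + n\<^sub>2\<close> are in the cone. If one of them is zero, the cyclic ray applies; otherwise \<open>z\<close> is a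
  positive rational multiple of a point of the disc between the directions of \<open>n\<^sub>1\<close> and \<open>n\<^sub>2\<close>.
\<close>

lemma interior_and_rays_imp_saturated:
  assumes int: "S - (\<tau>\<^sub>1 \<union> \<tau>\<^sub>2) = C - (\<tau>\<^sub>1 \<union> \<tau>\<^sub>2)"
    and ray: "S \<inter> \<tau>\<^sub>1 = range (\<lambda>k::nat. real k *\<^sub>R n\<^sub>1)" "S \<inter> \<tau>\<^sub>2 = range (\<lambda>k::nat. real k *\<^sub>R n\<^sub>2)"
    and z: "z + n\<^sub>1 \<in> S" "z + n\<^sub>2 \<in> S"
  shows "z \<in> S"
proof -
  let ?d = "cross n\<^sub>1 n\<^sub>2"
  define \<alpha> \<beta> where "\<alpha> = cross z n\<^sub>2 / ?d" and "\<beta> = cross n\<^sub>1 z / ?d"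
  have eq: "z = \<alpha> *\<^sub>R n\<^sub>1 + \<beta> *\<^sub>R n\<^sub>2"
    unfolding \<alpha>_def \<beta>_def using cramer[of n\<^sub>1 n\<^sub>2 z] cross_pos by simp
  have zC: "z + n\<^sub>1 \<in> C" "z + n\<^sub>2 \<in> C" using z semigroup_subset_cone by blast+
  have \<alpha>\<beta>: "0 \<le> \<alpha>" "0 \<le> \<beta>"
    unfolding \<alpha>_def \<beta>_def using cone_in_sector(1)[OF zC(2)] cone_in_sector(2)[OF zC(1)] cross_pos
    by (simp_all add: cross_simps)
  have nat: "n\<^sub>1 \<in> \<nat> \<times> \<nat>" "n\<^sub>2 \<in> \<nat> \<times> \<nat>" "z + n\<^sub>1 \<in> \<nat> \<times> \<nat>" using least_elements z plane_monoid_axioms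
    unfolding plane_monoid_def by blast+
  have "0 \<le> fst z" "0 \<le> snd z"
    using \<alpha>\<beta> nat_pair_nonneg[OF nat(1)] nat_pair_nonneg[OF nat(2)] unfolding eq by simp_all
  then have "(z + n\<^sub>1) - n\<^sub>1 \<in> \<nat> \<times> \<nat>" by (intro nat_pair_diff nat) simp_all
  then have znat: "z \<in> \<nat> \<times> \<nat>" by simp
  consider "\<alpha> = 0" | "\<beta> = 0" | "0 < \<alpha>" "0 < \<beta>" using \<alpha>\<beta> by linarith
  then show ?thesis
  proof cases
    case 1
    then have "z + n\<^sub>2 = (\<beta> + 1) *\<^sub>R n\<^sub>2" using eq by (simp add: scaleR_left_distrib)
    then have "z + n\<^sub>2 \<in> S \<inter> \<tau>\<^sub>2" using z(2) \<alpha>\<beta>(2) unfolding rays by fastforce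
    then obtain k :: nat where k: "z + n\<^sub>2 = real k *\<^sub>R n\<^sub>2" unfolding ray by blast
    then have "(\<beta> + 1) *\<^sub>R n\<^sub>2 = real k *\<^sub>R n\<^sub>2" using \<open>z + n\<^sub>2 = (\<beta> + 1) *\<^sub>R n\<^sub>2\<close> by simp
    then have "\<beta> + 1 = real k" using least_elements(5) by (metis scaleR_cancel_right)
    then have "\<beta> = real (k - 1)" using \<alpha>\<beta>(2) by (cases k) auto
    then show ?thesis using eq 1 scale_in[OF least_elements(4)] by simp
  next
    case 2
    then have "z + n\<^sub>1 = (\<alpha> + 1) *\<^sub>R n\<^sub>1" using eq by (simp add: scaleR_left_distrib)
    then have "z + n\<^sub>1 \<in> S \<inter> \<tau>\<^sub>1" using z(1) \<alpha>\<beta>(1) unfolding rays by fastforce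
    then obtain k :: nat where k: "z + n\<^sub>1 = real k *\<^sub>R n\<^sub>1" unfolding ray by blast
    then have "(\<alpha> + 1) *\<^sub>R n\<^sub>1 = real k *\<^sub>R n\<^sub>1" using \<open>z + n\<^sub>1 = (\<alpha> + 1) *\<^sub>R n\<^sub>1\<close> by simp
    then have "\<alpha> + 1 = real k" using least_elements(2) by (metis scaleR_cancel_right)
    then have "\<alpha> = real (k - 1)" using \<alpha>\<beta>(1) by (cases k) auto
    then show ?thesis using eq 2 scale_in[OF least_elements(1)] by simp
  next
    case 3
    obtain i m where im: "0 < i" "norm (m - c) \<le> r" "n\<^sub>1 = real i *\<^sub>R m"
      using circle_semigroup_multiple least_elements(1,2) unfolding S by blast
    obtain j m' where jm: "0 < j" "norm (m' - c) \<le> r" "n\<^sub>2 = real j *\<^sub>R m'"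
      using circle_semigroup_multiple least_elements(4,5) unfolding S by blast
    define p q where "p = \<alpha> * real i" and "q = \<beta> * real j"
    have pq: "0 < p" "0 < q" unfolding p_def q_def using 3 im(1) jm(1) by simp_all
    define w where "w = (p / (p + q)) *\<^sub>R m + (q / (p + q)) *\<^sub>R m'"
    have zw: "z = (p + q) *\<^sub>R w"
      using eq pq by (simp add: w_def im(3) jm(3) p_def q_def scaleR_right_distrib)
    have "w \<in> cball c r"
      unfolding w_def using im(2) jm(2) pq
      by (intro convexD[OF convex_cball]) (auto simp: dist_norm norm_minus_commute add_divide_distrib[symmetric])
    then have "norm (w - c) \<le> r" by (simp add: dist_norm norm_minus_commute)
    moreover have "0 \<le> fst w" "0 \<le> snd w"
      using nat_pair_nonneg[OF znat] pq unfolding zw by (simp_all add: zero_le_mult_iff)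
    moreover have "p + q \<in> \<rat>"
    proof -
      have "n\<^sub>1 + z \<in> \<nat> \<times> \<nat>" using nat(3) by (simp add: add.commute)
      then have "cross z n\<^sub>2 \<in> \<rat>" "cross n\<^sub>1 z \<in> \<rat>" "?d \<in> \<rat>"
        using cross_int nat(1,2) znat Ints_subset_Rats by blast+
      then show ?thesis unfolding p_def q_def \<alpha>_def \<beta>_def by simp
    qed
    ultimately have "z \<in> C" unfolding C circle_cone_iff using znat pq zw by (metis add_pos_pos)
    moreover have "cross n\<^sub>1 z \<noteq> 0" "cross z n\<^sub>2 \<noteq> 0" using 3 cross_pos by (auto simp: \<alpha>_def \<beta>_def)
    ultimately have "z \<in> C - (\<tau>\<^sub>1 \<union> \<tau>\<^sub>2)" using on_ray_iff by blast
    then show ?thesis using int by blast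
  qed
qed

text \<open>
  By Cramer's rule the determinant \<open>\<Delta>\<close> of \<open>n\<^sub>1, n\<^sub>2\<close> multiplies every element of \<open>S\<close> into
  \<open>\<nat> n\<^sub>1 + \<nat> n\<^sub>2\<close>. A combination of generators with large coordinate sum contains some nonzero
  generator at least \<open>\<Delta>\<close> times.
\<close>

lemma large_elements_divisible:
  assumes A: "finite A" "S = generated_semigroup A"
  shows "\<exists>D::nat. \<forall>s\<in>S. real D \<le> fst s + snd s \<longrightarrow> s - n\<^sub>1 \<in> S \<or> s - n\<^sub>2 \<in> S"
proof -
  let ?d = "cross n\<^sub>1 n\<^sub>2"
  have nat: "s \<in> \<nat> \<times> \<nat>" if "s \<in> S" for s using plane_monoid_axioms that unfolding plane_monoid_def by blast
  have natural: "\<exists>k::nat. x = real k" if "x \<in> \<int>" "0 \<le> x" for x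
    using that by (metis Ints_cases nonneg_int_cases of_int_0_le_iff of_int_of_nat_eq)
  obtain \<Delta> :: nat where \<Delta>: "?d = real \<Delta>" using natural cross_int nat least_elements(1,4) cross_pos by (metis less_imp_le)
  have multiple: "\<exists>i j::nat. real \<Delta> *\<^sub>R a = real i *\<^sub>R n\<^sub>1 + real j *\<^sub>R n\<^sub>2" if a: "a \<in> S" for a
  proof -
    have aC: "a \<in> C" using a semigroup_subset_cone by blast
    obtain i j :: nat where ij: "cross a n\<^sub>2 = real i" "cross n\<^sub>1 a = real j"
      using natural cross_int nat least_elements(1,4) a cone_in_sector[OF aC] by metis
    have "a = (real i / real \<Delta>) *\<^sub>R n\<^sub>1 + (real j / real \<Delta>) *\<^sub>R n\<^sub>2"
      using cramer[of n\<^sub>1 n\<^sub>2 a] cross_pos unfolding ij \<Delta> by simp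
    then have "real \<Delta> *\<^sub>R a = real \<Delta> *\<^sub>R ((real i / real \<Delta>) *\<^sub>R n\<^sub>1 + (real j / real \<Delta>) *\<^sub>R n\<^sub>2)"
      by simp
    also have "\<dots> = real i *\<^sub>R n\<^sub>1 + real j *\<^sub>R n\<^sub>2"
      using cross_pos unfolding \<Delta> scaleR_right_distrib by simp
    finally show ?thesis by blast
  qed
  have SA: "S = nat_combinations A" using A generated_semigroup_eq by simp
  have AS: "A \<subseteq> S"
  proof
    fix a assume "a \<in> A"
    then show "a \<in> S" using nat_combinations_scale[OF A(1), of a 1] SA by simp
  qed
  let ?deg = "\<lambda>s. fst s + snd s :: real"
  obtain D :: nat where D: "(\<Sum>a\<in>A. real \<Delta> * ?deg a) < real D" using reals_Archimedean2 by blast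
  have "s - n\<^sub>1 \<in> S \<or> s - n\<^sub>2 \<in> S" if s: "s \<in> S" "real D \<le> ?deg s" for s
  proof -
    obtain m :: "real \<times> real \<Rightarrow> nat" where m: "s = (\<Sum>a\<in>A. real (m a) *\<^sub>R a)"
      using s(1) unfolding SA nat_combinations_def by blast
    have "\<exists>a\<in>A. a \<noteq> 0 \<and> \<Delta> \<le> m a"
    proof (rule ccontr)
      assume "\<not> ?thesis"
      then have small: "real (m a) * ?deg a \<le> real \<Delta> * ?deg a" if "a \<in> A" for a
        using that nonneg[of a] AS by (cases "a = 0") (auto intro!: mult_right_mono)
      have "?deg s = (\<Sum>a\<in>A. real (m a) * ?deg a)"
        unfolding m by (simp add: fst_sum snd_sum sum.distrib[symmetric] distrib_left)
      also have "\<dots> \<le> (\<Sum>a\<in>A. real \<Delta> * ?deg a)" using small by (rule sum_mono)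
      finally show False using D s(2) by simp
    qed
    then obtain a where a: "a \<in> A" "a \<noteq> 0" "\<Delta> \<le> m a" by blast
    define t where "t = (\<Sum>b\<in>A. real ((m(a := m a - \<Delta>)) b) *\<^sub>R b)"
    have "t \<in> S" unfolding SA nat_combinations_def t_def by blast
    have st: "s = real \<Delta> *\<^sub>R a + t"
    proof -
      have "t = real (m a - \<Delta>) *\<^sub>R a + (\<Sum>b\<in>A - {a}. real (m b) *\<^sub>R b)"
        unfolding t_def by (subst sum.remove[OF A(1) a(1)]) (auto intro: sum.cong)
      moreover have "s = real (m a) *\<^sub>R a + (\<Sum>b\<in>A - {a}. real (m b) *\<^sub>R b)"
        unfolding m by (rule sum.remove[OF A(1) a(1)])
      ultimately show ?thesis using a(3) by (simp add: of_nat_diff scaleR_left_diff_distrib)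
    qed
    obtain i j :: nat where ij: "real \<Delta> *\<^sub>R a = real i *\<^sub>R n\<^sub>1 + real j *\<^sub>R n\<^sub>2"
      using multiple a(1) AS by blast
    have "real \<Delta> *\<^sub>R a \<noteq> 0" using a(2) cross_pos \<Delta> by simp
    then have "0 < i \<or> 0 < j" unfolding ij by auto
    then show ?thesis
    proof
      assume "0 < i"
      then have "s - n\<^sub>1 = (real (i - 1) *\<^sub>R n\<^sub>1 + real j *\<^sub>R n\<^sub>2) + t"
        unfolding st ij by (simp add: of_nat_diff scaleR_left_diff_distrib)
      then show ?thesis using add_in scale_in least_elements(1,4) \<open>t \<in> S\<close> by metis
    next
      assume "0 < j"
      then have "s - n\<^sub>2 = (real i *\<^sub>R n\<^sub>1 + real (j - 1) *\<^sub>R n\<^sub>2) + t"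
        unfolding st ij by (simp add: of_nat_diff scaleR_left_diff_distrib)
      then show ?thesis using add_in scale_in least_elements(1,4) \<open>t \<in> S\<close> by metis
    qed
  qed
  then show ?thesis by blast
qed

text \<open>
  The face used for the height bound is \<open>S \<inter> \<tau>\<^sub>1\<close>, the zero set on \<open>S\<close> of a linear form that is
  nonnegative on the cone.
\<close>

lemma cohen_macaulay_iff_saturated:
  fixes K :: "'k::field itself"
  assumes A: "finite A" "S = generated_semigroup A"
  shows "cohen_macaulay_semigroup K S \<longleftrightarrow> (\<forall>z. z + n\<^sub>1 \<in> S \<longrightarrow> z + n\<^sub>2 \<in> S \<longrightarrow> z \<in> S)"
proof
  assume cm: "cohen_macaulay_semigroup K S"
  obtain D :: nat where D: "\<And>s. s \<in> S \<Longrightarrow> real D \<le> fst s + snd s \<Longrightarrow> s - n\<^sub>1 \<in> S \<or> s - n\<^sub>2 \<in> S"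
    using large_elements_divisible[OF A] by blast
  let ?F = "S \<inter> \<tau>\<^sub>1"
  have F_iff: "x \<in> ?F \<longleftrightarrow> x \<in> S \<and> cross n\<^sub>1 x = 0" for x using on_ray_iff(1) semigroup_subset_cone by blast
  have "0 \<in> ?F" "n\<^sub>1 \<in> ?F" "n\<^sub>2 \<notin> ?F"
    unfolding F_iff using zero_in least_elements cross_pos by (auto simp: cross_def)
  then have F: "?F \<subseteq> S" "0 \<in> ?F" "?F \<noteq> {0}" "?F \<noteq> S" using least_elements by blast+
  have "x + y \<in> ?F \<longleftrightarrow> x \<in> ?F \<and> y \<in> ?F" if xy: "x \<in> S" "y \<in> S" for x y
  proof -
    have "0 \<le> cross n\<^sub>1 x" "0 \<le> cross n\<^sub>1 y" using cone_in_sector(2) semigroup_subset_cone xy by blast+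
    then show ?thesis
      unfolding F_iff using xy add_in[OF xy] by (auto simp: cross_simps add_nonneg_eq_0_iff)
  qed
  from cohen_macaulay_imp_saturated[OF cm F this D]
  show "\<forall>z. z + n\<^sub>1 \<in> S \<longrightarrow> z + n\<^sub>2 \<in> S \<longrightarrow> z \<in> S" by blast
next
  assume "\<forall>z. z + n\<^sub>1 \<in> S \<longrightarrow> z + n\<^sub>2 \<in> S \<longrightarrow> z \<in> S"
  then show "cohen_macaulay_semigroup K S"
    by (intro saturated_imp_cohen_macaulay[OF A _ least_elements(1,2,4,5)]) blast
qed

end

theorem proposition8:
  fixes a b r :: real
    and S C \<tau>\<^sub>1 \<tau>\<^sub>2 :: "(real \<times> real) set"
    and n\<^sub>1 n\<^sub>2 :: "real \<times> real"
  assumes "r > 0"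
    and "S = circle_semigroup (a, b) r"
    and "C = circle_cone (a, b) r"
    and "extremal_ray C \<tau>\<^sub>1" and "extremal_ray C \<tau>\<^sub>2" and "steeper \<tau>\<^sub>1 \<tau>\<^sub>2"
    and "least_on_ray S \<tau>\<^sub>1 n\<^sub>1" and "least_on_ray S \<tau>\<^sub>2 n\<^sub>2"
    and "simplicial_affine_semigroup S"
    and "S \<noteq> C"
  shows "cohen_macaulay_semigroup TYPE('k::field) S \<longleftrightarrow>
    S - (\<tau>\<^sub>1 \<union> \<tau>\<^sub>2) = C - (\<tau>\<^sub>1 \<union> \<tau>\<^sub>2) \<and>
    S \<inter> \<tau>\<^sub>1 = range (\<lambda>k::nat. real k *\<^sub>R n\<^sub>1) \<and>
    S \<inter> \<tau>\<^sub>2 = range (\<lambda>k::nat. real k *\<^sub>R n\<^sub>2)"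
proof -
  interpret circle_rays "(a, b)" r S C \<tau>\<^sub>1 \<tau>\<^sub>2 n\<^sub>1 n\<^sub>2
    using assms(2-8) by (rule circle_rays.intro)
  obtain A where A: "finite A" "S = generated_semigroup A"
    using assms(9) unfolding simplicial_affine_semigroup_def affine_semigroup_def by blast
  show ?thesis
    unfolding cohen_macaulay_iff_saturated[OF A]
    using saturated_imp_interior_and_rays interior_and_rays_imp_saturated by meson
qed

end
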